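(* Let $k$ be a field, let $(V,B)$ be a Steiner system of type $S(t,n,v)$ with $1\le t<n<v$, let $C=C_{(n,v)}\setminus B$, and let $X_C\subset\mathbb P^n$ be the Complement of the Steiner configuration of points with respect to hyperplanes $H_1,\dots,H_v$ of $\mathbb P^n$ any $n+1$ of whose defining linear forms are linearly independent. (1) If $t=n-1$, then $$\frac{(v-n)n}{v}=\rho_a(I_{X_C})\le\rho(I_{X_C})\le\frac{(v-n+1)n}{v}.$$ (2) If $t<n-1$, then $$\frac{(v-n)n}{v}\le\rho_a(I_{X_C})\le\rho(I_{X_C})\le\frac{(v-n+1)n}{v}.$$
   Context: A Steiner system $(V,B)$ of type $S(t,n,v)$ consists of a set $V=\{1,\dots,v\}$ and a collection $B$ of $n$-subsets of $V$ (blocks) such that every $t$-subset of $V$ is contained in exactly one block. $C_{(n,v)}$ denotes the set of all $n$-subsets of $V$. Let $H_j$ be defined by the linear form $\ell_j$. For an $n$-subset $\sigma$ of $V$ put $P_\sigma=\bigcap_{i\in\sigma}H_i$, a point with ideal $I_{P_\sigma}=(\ell_i:i\in\sigma)\subseteq k[x_0,\dots,x_n]$. Then $X_C=\{P_\sigma:\sigma\in C\}$, $I_{X_C}=\bigcap_{\sigma\in C}I_{P_\sigma}$, and the symbolic powers are $I_{X_C}^{(m)}=\bigcap_{\sigma\in C}I_{P_\sigma}^m$. For such an ideal $I$, the resurgence is $\rho(I)=\sup\{m/r : I^{(m)}\not\subseteq I^r\}$ and the asymptotic resurgence is $\rho_a(I)=\sup\{m/r : I^{(ms)}\not\subseteq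 I^{rs}\text{ for all } s\gg0\}$ ($m,r$ positive integers). *)

theory Defs
  imports
    "HOL-Library.Poly_Mapping"
    "HOL-Library.Extended_Real"
    "HOL-Algebra.Subrings"
    "HOL-Algebra.Ideal_Product"
    "HOL-Algebra.Algebraic_Closure_Type"
begin

section \<open>The polynomial ring\<close>

type_synonym 'k mpoly = "(nat \<Rightarrow>\<^sub>0 nat) \<Rightarrow>\<^sub>0 'k"

text \<open>
  A polynomial maps each monomial, given by its exponents, to its coefficient; the ring below is
  \<open>k[x\<^sub>0, \<dots>, x\<^sub>n]\<close>, inside the polynomials in countably many variables.
\<close>

definition mpoly_ring :: "nat \<Rightarrow> 'k::field mpoly ring" where
  "mpoly_ring n = ring_of_type_algebra
     \<lparr>carrier := {p. \<forall>m \<in> Poly_Mapping.keys p. Poly_Mapping.keys m \<subseteq> {..n}}\<rparr>"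

lemma cring_mpoly_ring: "cring (mpoly_ring n :: 'k::field mpoly ring)"
proof -
  interpret R: cring "ring_of_type_algebra :: 'k mpoly ring"
    by (rule cring_from_type_algebra)
  let ?S = "{p :: 'k mpoly. \<forall>m \<in> Poly_Mapping.keys p. Poly_Mapping.keys m \<subseteq> {..n}}"
  have inv: "\<ominus>\<^bsub>ring_of_type_algebra\<^esub> p = - p" for p :: "'k mpoly"
    by (rule R.minus_equality) (auto simp: ring_of_type_algebra_def)
  have "subcring ?S (ring_of_type_algebra :: 'k mpoly ring)"
  proof (rule R.subcringI', rule R.subringI)
    fix p q :: "'k mpoly" assume p: "p \<in> ?S" and q: "q \<in> ?S"
    show "\<ominus>\<^bsub>ring_of_type_algebra\<^esub> p \<in> ?S" using p by (simp add: inv)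
    show "p \<oplus>\<^bsub>ring_of_type_algebra\<^esub> q \<in> ?S"
      using p q Poly_Mapping.keys_add[of p q] by (auto simp: ring_of_type_algebra_def)
    show "p \<otimes>\<^bsub>ring_of_type_algebra\<^esub> q \<in> ?S"
    proof (simp add: ring_of_type_algebra_def, safe)
      fix m i assume "m \<in> Poly_Mapping.keys (p * q)" and i: "i \<in> Poly_Mapping.keys m"
      then obtain a b where ab: "a \<in> Poly_Mapping.keys p" "b \<in> Poly_Mapping.keys q" "m = a + b"
        using keys_mult[of p q] by blast
      then have "Poly_Mapping.keys m \<subseteq> {..n}"
        using p q Poly_Mapping.keys_add[of a b] by blast
      then show "i \<le> n" using i by auto
    qed
  qed (auto simp: ring_of_type_algebra_def)
  then show ?thesis
    unfolding mpoly_ring_def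
    using R.subcring_iff[of ?S] by (simp add: ring_of_type_algebra_def)
qed

definition linear_form :: "nat \<Rightarrow> 'k::field mpoly \<Rightarrow> bool" where
  "linear_form n p \<longleftrightarrow> Poly_Mapping.keys p \<subseteq> (\<lambda>i. Poly_Mapping.single i 1) ` {..n}"

text \<open>
  Linear independence over \<open>k\<close> of the family \<open>(l i)\<close>, \<open>i \<in> \<sigma>\<close>, for finite \<open>\<sigma>\<close>;
  \<open>Poly_Mapping.single 0 a\<close> is the constant polynomial \<open>a\<close>. Since this concerns the family
  rather than its set of values, it excludes repeated forms.
\<close>

definition lin_indep_family :: "(nat \<Rightarrow> 'k::field mpoly) \<Rightarrow> nat set \<Rightarrow> bool" where
  "lin_indep_family l \<sigma> \<longleftrightarrow>
     (\<forall>c. (\<Sum>i\<in>\<sigma>. Poly_Mapping.single 0 (c i) * l i) = 0 \<longrightarrow> (\<forall>i\<in>\<sigma>. c i = 0))"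

section \<open>Steiner systems\<close>

definition subsets_of_size :: "nat \<Rightarrow> nat \<Rightarrow> nat set set" where
  "subsets_of_size n v = {\<sigma>. \<sigma> \<subseteq> {1..v} \<and> card \<sigma> = n}"

definition steiner_system :: "nat \<Rightarrow> nat \<Rightarrow> nat \<Rightarrow> nat set set \<Rightarrow> bool" where
  "steiner_system t n v B \<longleftrightarrow>
     B \<subseteq> subsets_of_size n v \<and> (\<forall>T \<in> subsets_of_size t v. \<exists>!\<beta>. \<beta> \<in> B \<and> T \<subseteq> \<beta>)"

section \<open>Ideals of configurations of points\<close>

text \<open>
  The points are \<open>P\<^sub>\<sigma> = \<Inter>\<^sub>i\<^sub>\<in>\<^sub>\<sigma> H\<^sub>i\<close>, where \<open>H\<^sub>i\<close> is the hyperplane \<open>l i = 0\<close>, and a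
  configuration is given by its set \<open>C\<close> of indices \<open>\<sigma>\<close>.
  Powers of ideals are powers in the multiplicative monoid of ideals, whose unit is the whole ring.
\<close>

definition point_ideal :: "nat \<Rightarrow> (nat \<Rightarrow> 'k::field mpoly) \<Rightarrow> nat set \<Rightarrow> 'k mpoly set" where
  "point_ideal n l \<sigma> = Idl\<^bsub>mpoly_ring n\<^esub> (l ` \<sigma>)"

definition config_ideal :: "nat \<Rightarrow> (nat \<Rightarrow> 'k::field mpoly) \<Rightarrow> nat set set \<Rightarrow> 'k mpoly set" where
  "config_ideal n l C = carrier (mpoly_ring n) \<inter> (\<Inter>\<sigma>\<in>C. point_ideal n l \<sigma>)"

definition config_symbolic_power ::
    "nat \<Rightarrow> (nat \<Rightarrow> 'k::field mpoly) \<Rightarrow> nat set set \<Rightarrow> nat \<Rightarrow> 'k mpoly set" where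
  "config_symbolic_power n l C m =
     carrier (mpoly_ring n) \<inter> (\<Inter>\<sigma>\<in>C. point_ideal n l \<sigma> [^]\<^bsub>ideals_set (mpoly_ring n)\<^esub> m)"

text \<open>
  The suprema are taken in the extended reals, so that no boundedness is presupposed.
\<close>

definition resurgence :: "nat \<Rightarrow> (nat \<Rightarrow> 'k::field mpoly) \<Rightarrow> nat set set \<Rightarrow> ereal" where
  "resurgence n l C = Sup {ereal (real m / real r) | m r. 0 < m \<and> 0 < r \<and>
     \<not> config_symbolic_power n l C m \<subseteq> config_ideal n l C [^]\<^bsub>ideals_set (mpoly_ring n)\<^esub> r}"

definition asymptotic_resurgence :: "nat \<Rightarrow> (nat \<Rightarrow> 'k::field mpoly) \<Rightarrow> nat set set \<Rightarrow> ereal" where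
  "asymptotic_resurgence n l C = Sup {ereal (real m / real r) | m r. 0 < m \<and> 0 < r \<and>
     (\<forall>\<^sub>F s in sequentially. \<not> config_symbolic_power n l C (m * s)
        \<subseteq> config_ideal n l C [^]\<^bsub>ideals_set (mpoly_ring n)\<^esub> (r * s))}"

end

(*
  The complement C of the blocks is the set of bases of a matroid, because two blocks differ in at
  least two points. For matroids, induction by contraction shows that every symbolic power of
  I = I_{X_C} is spanned over the polynomial ring by products l^b = prod l_i^(b_i): those whose
  exponents satisfy sum_{i in sigma} b_i >= m for all sigma in C. The containments I^(m) <= I^r thus
  become statements about exponent vectors.

  Lower bound: (l_1 ... l_v)^j lies in I^(nj) and has degree vj, while I^r starts in degree r(v - n).
  Upper bounds: at most one block violates the inequality for m, and dividing by powers of its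
  generator prod_{i not in beta} l_i reduces to exponents satisfying the inequality for all
  n-subsets. Such a vector is a sum of r indicators of complements of (n-1)-subsets as soon as
  m v >= r (v - n + 1) n. If t = n - 1, peeling off multiples of indicators of complements of
  growing sets K, each of which is a fractional combination of complements of the blocks
  containing K, improves this to m v >= r (v - n) n up to a bounded error.
*)

theory Submission
  imports Defs
begin

section \<open>Substitution in polynomials\<close>

text \<open>For v > n + 1 the forms are linearly dependent, so a polynomial does not determine
  exponents \<open>b\<close>. But any n + 1 of the forms are coordinates, and one base \<sigma> with
  one further index \<open>i\<close> involves at most n + 1 forms. Division by \<open>l i\<close>
  can thus be controlled for each \<sigma> separately, which is all that the contraction needs. The
  constants come from averaging: if every n-subset has exponent sum at least m, the total degree is
  at least m v / n, to be spent on generators of degree v - n + 1. Blocks give the smaller degree v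
  - n, but the blocks over K are known to cover the other points evenly only for card K < t. For t =
  n - 1 this leaves just the sets K with n - 1 points, and their own complements are cheap enough
  because v <= (v - n) n.\<close>

definition mon_subst :: "(nat \<Rightarrow> 'k::comm_ring_1 mpoly) \<Rightarrow> (nat \<Rightarrow>\<^sub>0 nat) \<Rightarrow> 'k mpoly" where
  "mon_subst h m = (\<Prod>i\<in>Poly_Mapping.keys m. h i ^ Poly_Mapping.lookup m i)"

text \<open>The k-algebra homomorphism sending the variable \<open>i\<close> to \<open>h i\<close>;
  it serves as change of coordinates in both directions.\<close>

definition subst :: "(nat \<Rightarrow> 'k::comm_ring_1 mpoly) \<Rightarrow> 'k mpoly \<Rightarrow> 'k mpoly" where
  "subst h p = (\<Sum>m\<in>Poly_Mapping.keys p. Poly_Mapping.single 0 (Poly_Mapping.lookup p m) * mon_subst h m)"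

lemma mon_subst_superset:
  assumes "finite S" "Poly_Mapping.keys m \<subseteq> S"
  shows "mon_subst h m = (\<Prod>i\<in>S. h i ^ Poly_Mapping.lookup m i)"
  unfolding mon_subst_def using assms
  by (intro prod.mono_neutral_left) (auto simp: in_keys_iff)

lemma mon_subst_add: "mon_subst h (a + b) = mon_subst h a * mon_subst h b"
proof -
  let ?S = "Poly_Mapping.keys a \<union> Poly_Mapping.keys b"
  have "Poly_Mapping.keys (a + b) \<subseteq> ?S" by (rule Poly_Mapping.keys_add)
  then show ?thesis
    by (simp add: mon_subst_superset[of ?S] lookup_add power_add prod.distrib)
qed

lemma mon_subst_0 [simp]: "mon_subst h 0 = 1"
  by (simp add: mon_subst_def)

lemma mon_subst_single: "mon_subst h (Poly_Mapping.single i e) = h i ^ e"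
  by (cases "e = 0") (simp_all add: mon_subst_def)

lemma subst_superset:
  assumes "finite S" "Poly_Mapping.keys p \<subseteq> S"
  shows "subst h p = (\<Sum>m\<in>S. Poly_Mapping.single 0 (Poly_Mapping.lookup p m) * mon_subst h m)"
  unfolding subst_def using assms
  by (intro sum.mono_neutral_left) (auto simp: in_keys_iff)

lemma subst_0 [simp]: "subst h 0 = 0"
  by (simp add: subst_def)

lemma subst_add: "subst h (p + q) = subst h p + subst h q"
proof -
  let ?S = "Poly_Mapping.keys p \<union> Poly_Mapping.keys q"
  have "Poly_Mapping.keys (p + q) \<subseteq> ?S" by (rule Poly_Mapping.keys_add)
  then show ?thesis
    by (simp add: subst_superset[of ?S] lookup_add single_add distrib_right sum.distrib)
qed

lemma subst_sum: "subst h (sum f S) = (\<Sum>x\<in>S. subst h (f x))"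
  by (induction S rule: infinite_finite_induct) (auto simp: subst_add)

lemma subst_single: "subst h (Poly_Mapping.single m c) = Poly_Mapping.single 0 c * mon_subst h m"
  by (cases "c = 0") (simp_all add: subst_def)

lemma poly_mapping_sum_single:
  "p = (\<Sum>m\<in>Poly_Mapping.keys p. Poly_Mapping.single m (Poly_Mapping.lookup p m))"
  by (rule poly_mapping_eqI)
    (auto simp: lookup_sum lookup_single when_def in_keys_iff sum.delta)

lemma subst_mult: "subst h (p * q) = subst h p * subst h q"
proof -
  let ?c = Poly_Mapping.lookup and ?s = Poly_Mapping.single
  have "p * q = (\<Sum>m\<in>Poly_Mapping.keys p. \<Sum>m'\<in>Poly_Mapping.keys q. ?s (m + m') (?c p m * ?c q m'))"
    by (subst (1) poly_mapping_sum_single[of p], subst (1) poly_mapping_sum_single[of q])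
      (simp add: sum_product mult_single)
  then have "subst h (p * q) = (\<Sum>m\<in>Poly_Mapping.keys p. \<Sum>m'\<in>Poly_Mapping.keys q.
      (?s 0 (?c p m) * mon_subst h m) * (?s 0 (?c q m') * mon_subst h m'))"
    by (simp add: subst_sum subst_single mon_subst_add mult_single[of 0 _ 0, simplified, symmetric] mult_ac)
  also have "\<dots> = subst h p * subst h q"
    by (simp add: subst_def sum_product)
  finally show ?thesis .
qed

lemma subst_1 [simp]: "subst h 1 = 1"
  using subst_single[of h 0 1] by simp

lemma subst_power: "subst h (p ^ e) = subst h p ^ e"
  by (induction e) (auto simp: subst_mult)

lemma subst_prod: "subst h (prod f S) = (\<Prod>x\<in>S. subst h (f x))"
  by (induction S rule: infinite_finite_induct) (auto simp: subst_mult)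

lemma subst_const: "subst h (Poly_Mapping.single 0 c) = Poly_Mapping.single 0 c"
  by (simp add: subst_single)

abbreviation var :: "nat \<Rightarrow> 'k::comm_ring_1 mpoly" where
  "var i \<equiv> Poly_Mapping.single (Poly_Mapping.single i 1) 1"

lemma subst_var: "subst h (var i) = h i"
  by (simp add: subst_single mon_subst_single)

lemma prod_var_power:
  assumes "finite S"
  shows "(\<Prod>i\<in>S. var i ^ e i) = (Poly_Mapping.single (\<Sum>i\<in>S. Poly_Mapping.single i (e i)) 1 :: 'k::comm_ring_1 mpoly)"
proof -
  have power_var: "var i ^ e = (Poly_Mapping.single (Poly_Mapping.single i e) 1 :: 'k mpoly)" for i e
    by (induction e) (auto simp: mult_single single_add[symmetric] simp flip: single_one)
  show ?thesis
    using assms by induction (auto simp: power_var mult_single simp del: One_nat_def)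
qed

lemma subst_id:
  assumes "\<And>m i. m \<in> Poly_Mapping.keys p \<Longrightarrow> i \<in> Poly_Mapping.keys m \<Longrightarrow> subst g (h i) = var i"
  shows "subst g (subst h p) = p"
proof -
  have "subst g (mon_subst h m) = Poly_Mapping.single m 1" if "m \<in> Poly_Mapping.keys p" for m
  proof -
    have "subst g (mon_subst h m) = (\<Prod>i\<in>Poly_Mapping.keys m. var i ^ Poly_Mapping.lookup m i)"
      unfolding mon_subst_def subst_prod subst_power using assms[OF that] by simp
    also have "\<dots> = Poly_Mapping.single m 1"
      by (simp add: prod_var_power del: One_nat_def flip: poly_mapping_sum_single)
    finally show ?thesis .
  qed
  then have "subst g (subst h p) = (\<Sum>m\<in>Poly_Mapping.keys p. Poly_Mapping.single m (Poly_Mapping.lookup p m))"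
    unfolding subst_def[of h] subst_sum subst_mult subst_const
    by (simp add: mult_single)
  then show ?thesis by (simp flip: poly_mapping_sum_single)
qed

section \<open>Coordinates given by independent linear forms\<close>

lemma mpoly_ring_simps [simp]:
  "x \<otimes>\<^bsub>mpoly_ring n\<^esub> y = x * y" "x \<oplus>\<^bsub>mpoly_ring n\<^esub> y = x + y"
  "\<one>\<^bsub>mpoly_ring n\<^esub> = 1" "\<zero>\<^bsub>mpoly_ring n\<^esub> = 0"
  by (simp_all add: mpoly_ring_def ring_of_type_algebra_def)

lemma mem_mpoly_ring:
  "p \<in> carrier (mpoly_ring n) \<longleftrightarrow> (\<forall>m\<in>Poly_Mapping.keys p. Poly_Mapping.keys m \<subseteq> {..n})"
  by (simp add: mpoly_ring_def)

lemma mpoly_ring_closed [intro]: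
  fixes p q :: "'k::field mpoly"
  shows "0 \<in> carrier (mpoly_ring n :: 'k mpoly ring)" "1 \<in> carrier (mpoly_ring n :: 'k mpoly ring)"
    "Poly_Mapping.single 0 c \<in> carrier (mpoly_ring n :: 'k mpoly ring)"
    "p \<in> carrier (mpoly_ring n) \<Longrightarrow> q \<in> carrier (mpoly_ring n) \<Longrightarrow> p + q \<in> carrier (mpoly_ring n)"
    "p \<in> carrier (mpoly_ring n) \<Longrightarrow> q \<in> carrier (mpoly_ring n) \<Longrightarrow> p * q \<in> carrier (mpoly_ring n)"
    "p \<in> carrier (mpoly_ring n) \<Longrightarrow> - p \<in> carrier (mpoly_ring n)"
    "p \<in> carrier (mpoly_ring n) \<Longrightarrow> p ^ e \<in> carrier (mpoly_ring n)"
proof -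
  interpret R: cring "mpoly_ring n :: 'k mpoly ring" by (rule cring_mpoly_ring)
  show "0 \<in> carrier (mpoly_ring n :: 'k mpoly ring)" using R.zero_closed by simp
  show 1: "1 \<in> carrier (mpoly_ring n :: 'k mpoly ring)" using R.one_closed by simp
  show "Poly_Mapping.single 0 c \<in> carrier (mpoly_ring n :: 'k mpoly ring)"
    by (simp add: mem_mpoly_ring)
  show "p \<in> carrier (mpoly_ring n) \<Longrightarrow> q \<in> carrier (mpoly_ring n) \<Longrightarrow> p + q \<in> carrier (mpoly_ring n)"
    using R.a_closed[of p q] by simp
  show mult: "p \<in> carrier (mpoly_ring n) \<Longrightarrow> q \<in> carrier (mpoly_ring n) \<Longrightarrow> p * q \<in> carrier (mpoly_ring n)" for p q :: "'k mpoly"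
    using R.m_closed[of p q] by simp
  show "p \<in> carrier (mpoly_ring n) \<Longrightarrow> - p \<in> carrier (mpoly_ring n)"
    by (simp add: mem_mpoly_ring)
  show "p \<in> carrier (mpoly_ring n) \<Longrightarrow> p ^ e \<in> carrier (mpoly_ring n)"
    by (induction e) (auto intro: 1 mult)
qed

lemma mpoly_ring_prod_closed:
  fixes f :: "'i \<Rightarrow> 'k::field mpoly"
  shows "(\<And>i. i \<in> S \<Longrightarrow> f i \<in> carrier (mpoly_ring n)) \<Longrightarrow> prod f S \<in> carrier (mpoly_ring n)"
  by (induction S rule: infinite_finite_induct) auto

lemma linear_form_closed: "linear_form n p \<Longrightarrow> p \<in> carrier (mpoly_ring n)"
  by (auto simp: linear_form_def mem_mpoly_ring)

lemma inj_single_one: "inj_on (\<lambda>i. Poly_Mapping.single i (1::nat)) S"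
  by (rule inj_onI) (metis lookup_single_eq lookup_single_not_eq zero_neq_one)

lemma linear_form_expand:
  assumes "linear_form n p"
  shows "p = (\<Sum>i\<le>n. Poly_Mapping.single 0 (Poly_Mapping.lookup p (Poly_Mapping.single i 1)) * var i)"
proof -
  have "p = (\<Sum>m\<in>(\<lambda>i. Poly_Mapping.single i 1) ` {..n}. Poly_Mapping.single m (Poly_Mapping.lookup p m))"
    using assms by (subst poly_mapping_sum_single[of p], intro sum.mono_neutral_left)
      (auto simp: linear_form_def in_keys_iff)
  then show ?thesis
    by (simp add: sum.reindex[OF inj_single_one] mult_single o_def del: One_nat_def)
qed

locale generic_forms =
  fixes n v :: nat and l :: "nat \<Rightarrow> 'k::field mpoly"
  assumes linear: "j \<in> {1..v} \<Longrightarrow> linear_form n (l j)"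
    and indep: "\<sigma> \<in> subsets_of_size (n + 1) v \<Longrightarrow> lin_indep_family l \<sigma>"
begin

abbreviation A :: "'k mpoly set" where "A \<equiv> carrier (mpoly_ring n)"

lemma l_closed: "j \<in> {1..v} \<Longrightarrow> l j \<in> A"
  using linear linear_form_closed by blast

text \<open>The variables with index at most \<open>n\<close> span a space of dimension at most n +
  1, which contains the n + 1 independent forms of \<tau>; a variable outside the span of these
  would give n + 2 independent vectors.\<close>

lemma var_in_span:
  assumes \<tau>: "\<tau> \<in> subsets_of_size (n + 1) v" and i: "i \<le> n"
  shows "\<exists>c. var i = (\<Sum>j\<in>\<tau>. Poly_Mapping.single 0 (c j) * l j)"
proof -
  interpret vs: vector_space "\<lambda>c (p :: 'k mpoly). Poly_Mapping.single 0 c * p"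
    by unfold_locales
      (auto simp: algebra_simps single_add mult_single mult.assoc[symmetric] simp flip: single_one)
  have sub: "\<tau> \<subseteq> {1..v}" and card: "card \<tau> = n + 1" and fin: "finite \<tau>"
    using \<tau> by (auto simp: subsets_of_size_def intro: finite_subset)
  have ind: "(\<Sum>j\<in>\<tau>. Poly_Mapping.single 0 (c j) * l j) = 0 \<Longrightarrow> j \<in> \<tau> \<Longrightarrow> c j = 0" for c j
    using indep[OF \<tau>] by (auto simp: lin_indep_family_def)
  \<comment> \<open>Independence in \<open>vector_space\<close> concerns sets, so repetitions are
    excluded first: equal forms satisfy the relation with coefficients 1 and -1.\<close>
  have inj: "inj_on l \<tau>"
  proof (rule inj_onI, rule ccontr)
    fix a b assume ab: "a \<in> \<tau>" "b \<in> \<tau>" "l a = l b" "a \<noteq> b"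
    let ?c = "\<lambda>j. if j = a then 1 else if j = b then -1 else 0 :: 'k"
    have "(\<Sum>j\<in>\<tau>. Poly_Mapping.single 0 (?c j) * l j) = (\<Sum>j\<in>{a, b}. Poly_Mapping.single 0 (?c j) * l j)"
      using fin ab by (intro sum.mono_neutral_right) auto
    also have "\<dots> = 0" using ab by (simp add: single_uminus)
    finally show False using ind[of ?c a] ab by simp
  qed
  have indepS: "vs.independent (l ` \<tau>)"
  proof (rule vs.independent_if_scalars_zero)
    fix f x assume *: "(\<Sum>x\<in>l ` \<tau>. Poly_Mapping.single 0 (f x) * x) = 0" and x: "x \<in> l ` \<tau>"
    then obtain j where j: "j \<in> \<tau>" "x = l j" by blast
    have "(\<Sum>j\<in>\<tau>. Poly_Mapping.single 0 (f (l j)) * l j) = 0"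
      using * by (simp add: sum.reindex[OF inj])
    from ind[OF this j(1)] j(2) show "f x = 0" by simp
  qed (use fin in simp)
  let ?T = "var ` {..n} :: 'k mpoly set"
  have T: "finite ?T" "card ?T \<le> n + 1"
    using card_image_le[of "{..n}" var] by auto
  have span_l: "l j \<in> vs.span ?T" if "j \<in> \<tau>" for j
    by (subst linear_form_expand[OF linear]) (use that sub in \<open>auto simp del: One_nat_def intro!: vs.span_sum vs.span_scale intro: vs.span_base\<close>)
  have "var i \<in> vs.span (l ` \<tau>)"
  proof (rule ccontr)
    assume notin: "var i \<notin> vs.span (l ` \<tau>)"
    then have ind': "vs.independent (insert (var i) (l ` \<tau>))"
      using indepS by (simp add: vs.independent_insert)
    have "insert (var i) (l ` \<tau>) \<subseteq> vs.span ?T"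
      using span_l i by (auto intro: vs.span_base)
    from vs.independent_span_bound[OF T(1) ind' this]
    have "card (insert (var i) (l ` \<tau>)) \<le> n + 1" using T(2) by simp
    moreover have "var i \<notin> l ` \<tau>" using notin vs.span_base by blast
    ultimately show False using fin card inj by (simp add: card_image)
  qed
  then obtain u where "var i = (\<Sum>x\<in>l ` \<tau>. Poly_Mapping.single 0 (u x) * x)"
    using fin by (auto simp: vs.span_finite)
  then show ?thesis by (intro exI[of _ "u \<circ> l"]) (simp add: sum.reindex[OF inj])
qed

text \<open>\<open>h\<close> writes each variable in terms of the forms in \<tau> and then replaces
  \<open>l j\<close> by the variable \<open>j\<close>. It is prescribed only for indices up to
  \<open>n\<close>, so substituting back is the identity on \<open>A\<close> only.\<close>

lemma coordinates:
  assumes \<tau>: "\<tau> \<in> subsets_of_size (n + 1) v"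
  obtains h where
    "\<And>f. f \<in> A \<Longrightarrow> subst (\<lambda>j. if j \<in> \<tau> then l j else 0) (subst h f) = f"
    "\<And>j. j \<in> \<tau> \<Longrightarrow> subst h (l j) = var j"
proof -
  let ?g = "\<lambda>j. if j \<in> \<tau> then l j else 0"
  have sub: "\<tau> \<subseteq> {1..v}" and fin: "finite \<tau>"
    using \<tau> by (auto simp: subsets_of_size_def intro: finite_subset)
  obtain c where c: "\<And>i. i \<le> n \<Longrightarrow> var i = (\<Sum>j\<in>\<tau>. Poly_Mapping.single 0 (c i j) * l j)"
    using var_in_span[OF \<tau>] by metis
  define h :: "nat \<Rightarrow> 'k mpoly" where "h i = (\<Sum>j\<in>\<tau>. Poly_Mapping.single 0 (c i j) * var j)" for i
  have gh: "subst ?g (h i) = var i" if "i \<le> n" for i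
    using c[OF that] by (simp add: h_def subst_sum subst_mult subst_const subst_var del: One_nat_def)
  have inv: "subst ?g (subst h f) = f" if "f \<in> A" for f
    using that gh by (intro subst_id) (auto simp: mem_mpoly_ring)
  have "subst h (l j) = var j" if j: "j \<in> \<tau>" for j
  proof -
    let ?d = "\<lambda>i. Poly_Mapping.lookup (l j) (Poly_Mapping.single i 1)"
    define e where "e k = (\<Sum>i\<le>n. ?d i * c i k)" for k
    have lj: "linear_form n (l j)" using j sub linear by blast
    have "subst h (l j) = (\<Sum>i\<le>n. Poly_Mapping.single 0 (?d i) * h i)"
      by (subst linear_form_expand[OF lj]) (simp add: subst_sum subst_mult subst_const subst_var del: One_nat_def)
    also have "\<dots> = (\<Sum>k\<in>\<tau>. \<Sum>i\<le>n. Poly_Mapping.single 0 (?d i * c i k) * var k)"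
      unfolding h_def sum_distrib_left
      by (subst sum.swap) (simp add: mult.assoc[symmetric] mult_single del: One_nat_def)
    also have "\<dots> = (\<Sum>k\<in>\<tau>. Poly_Mapping.single 0 (e k) * var k)"
    proof -
      have single_sum: "Poly_Mapping.single 0 (sum f S) = (\<Sum>i\<in>S. Poly_Mapping.single 0 (f i))"
        for f :: "nat \<Rightarrow> 'k" and S
        by (induction S rule: infinite_finite_induct) (auto simp: single_add)
      show ?thesis by (simp add: e_def single_sum sum_distrib_right del: One_nat_def)
    qed
    finally have hl: "subst h (l j) = (\<Sum>k\<in>\<tau>. Poly_Mapping.single 0 (e k) * var k)" .
    \<comment> \<open>Substituting back turns the expansion of \<open>subst h (l j)\<close> into a
      linear relation among the forms in \<tau>; independence then determines the coefficients
      \<open>e\<close>.\<close>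
    have "l j = subst ?g (subst h (l j))" using inv[OF linear_form_closed[OF lj]] by simp
    also have "\<dots> = (\<Sum>k\<in>\<tau>. Poly_Mapping.single 0 (e k) * l k)"
      by (simp add: hl subst_sum subst_mult subst_const subst_var del: One_nat_def)
    finally have lj_eq: "l j = (\<Sum>k\<in>\<tau>. Poly_Mapping.single 0 (e k) * l k)" .
    have delta: "(\<Sum>k\<in>\<tau>. Poly_Mapping.single 0 (if k = j then 1 else 0 :: 'k) * f k) = f j" for f
    proof -
      have "(\<Sum>k\<in>\<tau>. Poly_Mapping.single 0 (if k = j then 1 else 0 :: 'k) * f k) = (\<Sum>k\<in>\<tau>. if k = j then f k else 0)"
        by (rule sum.cong) auto
      then show ?thesis using j fin by simp
    qed
    have "(\<Sum>k\<in>\<tau>. Poly_Mapping.single 0 (e k - (if k = j then 1 else 0)) * l k) = 0"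
      using lj_eq delta[of l] by (simp only: single_diff left_diff_distrib sum_subtractf) simp
    then have "\<And>k. k \<in> \<tau> \<Longrightarrow> e k - (if k = j then 1 else 0) = 0"
      using indep[OF \<tau>, unfolded lin_indep_family_def, rule_format,
          of "\<lambda>k. e k - (if k = j then 1 else 0)"] by simp
    then have "\<And>k. k \<in> \<tau> \<Longrightarrow> e k = (if k = j then 1 else 0)" by simp
    then show ?thesis using delta[of var] by (simp add: hl del: One_nat_def cong: sum.cong)
  qed
  with inv show ?thesis by (rule that)
qed

end

section \<open>Ideals generated by products of linear forms\<close>

lemma lookup_single_mult:
  fixes p :: "('a::cancel_comm_monoid_add) \<Rightarrow>\<^sub>0 'b::comm_ring_1"
  shows "Poly_Mapping.lookup (Poly_Mapping.single a 1 * p) (a + m) = Poly_Mapping.lookup p m"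
proof -
  have "Poly_Mapping.single a 1 * p = (\<Sum>k\<in>Poly_Mapping.keys p. Poly_Mapping.single (a + k) (Poly_Mapping.lookup p k))"
    by (subst (1) poly_mapping_sum_single[of p]) (simp add: sum_distrib_left mult_single)
  then show ?thesis
    by (auto simp: lookup_sum lookup_single when_def in_keys_iff sum.delta)
qed

context generic_forms
begin

definition mon :: "(nat \<Rightarrow> nat) \<Rightarrow> 'k mpoly" where
  "mon b = (\<Prod>i\<in>{1..v}. l i ^ b i)"

text \<open>The ideal of \<open>A\<close> generated by these products, in a form that allows proofs
  term by term.\<close>

inductive_set gen :: "((nat \<Rightarrow> nat) \<Rightarrow> bool) \<Rightarrow> 'k mpoly set" for \<Phi> where
  gen_zero: "0 \<in> gen \<Phi>"
| gen_step: "r \<in> A \<Longrightarrow> \<Phi> b \<Longrightarrow> f \<in> gen \<Phi> \<Longrightarrow> r * mon b + f \<in> gen \<Phi>"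

lemma mon_closed: "mon b \<in> A"
  unfolding mon_def by (intro mpoly_ring_prod_closed mpoly_ring_closed l_closed)

lemma mon_add: "mon (\<lambda>i. a i + b i) = mon a * mon b"
  by (simp add: mon_def power_add prod.distrib)

lemma mon_Suc: "i \<in> {1..v} \<Longrightarrow> mon (b(i := Suc (b i))) = l i * mon b"
  by (simp add: mon_def prod.remove[of _ i])

lemma gen_closed: "f \<in> gen \<Phi> \<Longrightarrow> f \<in> A"
  by (induction rule: gen.induct) (auto intro: mon_closed)

lemma gen_add: "f \<in> gen \<Phi> \<Longrightarrow> g \<in> gen \<Phi> \<Longrightarrow> f + g \<in> gen \<Phi>"
  by (induction rule: gen.induct) (auto simp: add.assoc intro: gen.intros)

lemma gen_mult: "f \<in> gen \<Phi> \<Longrightarrow> r \<in> A \<Longrightarrow> r * f \<in> gen \<Phi>"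
  by (induction rule: gen.induct)
    (auto simp: distrib_left mult.assoc[symmetric] intro: gen.intros)

lemma gen_diff: "f \<in> gen \<Phi> \<Longrightarrow> g \<in> gen \<Phi> \<Longrightarrow> f - g \<in> gen \<Phi>"
  using gen_add[of f \<Phi> "(- 1) * g"] gen_mult[of g \<Phi> "- 1"] by auto

lemma gen_sum: "(\<And>x. x \<in> S \<Longrightarrow> f x \<in> gen \<Phi>) \<Longrightarrow> sum f S \<in> gen \<Phi>"
  by (induction S rule: infinite_finite_induct) (auto intro: gen_zero gen_add)

lemma gen_mon: "\<Phi> b \<Longrightarrow> mon b \<in> gen \<Phi>"
  using gen_step[of 1 \<Phi> b 0] gen_zero by auto

lemma gen_mono: "f \<in> gen \<Phi> \<Longrightarrow> (\<And>b. \<Phi> b \<Longrightarrow> \<Psi> b) \<Longrightarrow> f \<in> gen \<Psi>"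
  by (induction rule: gen.induct) (auto intro: gen.intros)

lemma gen_unit: "\<Phi> (\<lambda>_. 0) \<Longrightarrow> f \<in> A \<Longrightarrow> f \<in> gen \<Phi>"
  using gen_mult[OF gen_mon, of \<Phi> "\<lambda>_. 0" f] by (simp add: mon_def)

lemma gen_mult_l:
  assumes "g \<in> gen \<Phi>" "i \<in> {1..v}" "\<And>b. \<Phi> b \<Longrightarrow> \<Psi> (b(i := Suc (b i)))"
  shows "l i * g \<in> gen \<Psi>"
  using assms(1)
proof induction
  case (gen_step r b f)
  then have "r * mon (b(i := Suc (b i))) + l i * f \<in> gen \<Psi>"
    by (intro gen.gen_step assms(3)) auto
  then show ?case by (simp add: mon_Suc[OF assms(2)] algebra_simps)
qed (simp add: gen_zero)

text \<open>Division by \<open>l i\<close> with remainder in \<open>gen \<Psi>\<close>: generators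
  that fail \<open>\<Psi>\<close> contain the factor \<open>l i\<close>.\<close>

lemma gen_split:
  assumes "f \<in> gen \<Phi>" "i \<in> {1..v}" "\<And>b. \<Phi> b \<Longrightarrow> 0 < b i \<or> \<Psi> b"
  shows "\<exists>h\<in>gen \<Psi>. \<exists>g\<in>A. f = h + l i * g"
  using assms(1)
proof induction
  case gen_zero
  then show ?case by (intro bexI[of _ 0]) (auto intro: gen.gen_zero)
next
  case (gen_step r b f)
  then obtain h g where *: "h \<in> gen \<Psi>" "g \<in> A" "f = h + l i * g" by blast
  show ?case
  proof (cases "\<Psi> b")
    case True
    then have "r * mon b + h \<in> gen \<Psi>" using gen_step * by (intro gen.gen_step) auto
    then show ?thesis using * by (intro bexI[of _ "r * mon b + h"] bexI[of _ g]) auto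
  next
    case False
    then have "0 < b i" using assms(3) gen_step by blast
    then have "mon b = l i * mon (b(i := b i - 1))"
      using mon_Suc[OF assms(2), of "b(i := b i - 1)"] by simp
    then have "r * mon b + f = h + l i * (r * mon (b(i := b i - 1)) + g)"
      using * by (simp add: algebra_simps)
    moreover have "r * mon (b(i := b i - 1)) + g \<in> A"
      using gen_step * mon_closed by blast
    ultimately show ?thesis using * by blast
  qed
qed

text \<open>By \<open>up\<close>, \<open>\<Phi>\<close> is an upward closed condition on the
  exponents in \<tau> alone. In the coordinates given by \<tau> the ideal is therefore monomial, and
  membership is tested on each monomial.\<close>

lemma gen_iff_keys:
  assumes \<tau>: "\<tau> \<subseteq> {1..v}"
    and h1: "\<And>f. f \<in> A \<Longrightarrow> subst (\<lambda>j. if j \<in> \<tau> then l j else 0) (subst h f) = f"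
    and h2: "\<And>j. j \<in> \<tau> \<Longrightarrow> subst h (l j) = var j"
    and up: "\<forall>b b'. \<Phi> b \<longrightarrow> (\<forall>i\<in>\<tau>. b i \<le> b' i) \<longrightarrow> \<Phi> b'"
    and f: "f \<in> A"
  shows "f \<in> gen \<Phi> \<longleftrightarrow> (\<forall>m\<in>Poly_Mapping.keys (subst h f). \<Phi> (Poly_Mapping.lookup m))"
proof
  have fin: "finite \<tau>" using \<tau> finite_subset by blast
  assume "f \<in> gen \<Phi>"
  then show "\<forall>m\<in>Poly_Mapping.keys (subst h f). \<Phi> (Poly_Mapping.lookup m)"
  proof induction
    case (gen_step r b f)
    \<comment> \<open>Forms outside \<tau> become arbitrary polynomials; they only multiply the
      monomial given by the exponents in \<tau>, which \<open>up\<close> tolerates.\<close>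
    let ?q = "\<Prod>i\<in>{1..v} - \<tau>. subst h (l i) ^ b i"
    let ?e = "\<Sum>i\<in>\<tau>. Poly_Mapping.single i (b i)"
    have "subst h (mon b) = ?q * (\<Prod>i\<in>\<tau>. var i ^ b i)"
      by (simp add: mon_def subst_mult subst_prod subst_power h2 prod.subset_diff[OF \<tau>]
          del: One_nat_def cong: prod.cong)
    also have "(\<Prod>i\<in>\<tau>. var i ^ b i) = (Poly_Mapping.single ?e 1 :: 'k mpoly)"
      by (rule prod_var_power[OF fin])
    finally have eq: "subst h (r * mon b + f) = (subst h r * ?q) * Poly_Mapping.single ?e 1 + subst h f"
      by (simp add: subst_add subst_mult mult.assoc)
    show ?case
    proof
      fix m assume "m \<in> Poly_Mapping.keys (subst h (r * mon b + f))"
      then consider "m \<in> Poly_Mapping.keys (subst h f)"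
        | "m \<in> Poly_Mapping.keys ((subst h r * ?q) * Poly_Mapping.single ?e 1)"
        unfolding eq by (blast dest: subsetD[OF Poly_Mapping.keys_add])
      then show "\<Phi> (Poly_Mapping.lookup m)"
      proof cases
        case 2
        then obtain c where m: "m = c + ?e"
          using keys_mult[of "subst h r * ?q" "Poly_Mapping.single ?e (1::'k)"] by auto
        have "b i \<le> Poly_Mapping.lookup m i" if "i \<in> \<tau>" for i
          using that fin by (simp add: m lookup_add lookup_sum lookup_single when_def sum.delta)
        then show ?thesis using up gen_step.hyps(2) by blast
      qed (use gen_step in blast)
    qed
  qed simp
next
  let ?g = "\<lambda>j. if j \<in> \<tau> then l j else 0"
  assume *: "\<forall>m\<in>Poly_Mapping.keys (subst h f). \<Phi> (Poly_Mapping.lookup m)"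
  have "mon_subst ?g m \<in> gen \<Phi>" if m: "m \<in> Poly_Mapping.keys (subst h f)" for m
  proof (cases "Poly_Mapping.keys m \<subseteq> \<tau>")
    case True
    have "mon_subst ?g m = (\<Prod>i\<in>Poly_Mapping.keys m. l i ^ Poly_Mapping.lookup m i)"
      unfolding mon_subst_def using True by (intro prod.cong) auto
    also have "\<dots> = mon (Poly_Mapping.lookup m)"
      unfolding mon_def using True \<tau> by (intro prod.mono_neutral_left) (auto simp: in_keys_iff)
    finally show ?thesis using * m by (simp add: gen_mon)
  next
    case False
    then obtain i where "i \<in> Poly_Mapping.keys m" "i \<notin> \<tau>" by blast
    then have "mon_subst ?g m = 0"
      unfolding mon_subst_def by (intro prod_zero) (auto simp: in_keys_iff)
    then show ?thesis by (simp add: gen_zero)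
  qed
  then have "subst ?g (subst h f) \<in> gen \<Phi>"
    unfolding subst_def[of ?g] by (intro gen_sum gen_mult) auto
  then show "f \<in> gen \<Phi>" using h1[OF f] by simp
qed

text \<open>In the coordinates of \<tau> the form \<open>l i\<close> is a variable, and division by
  a variable shifts the exponents of a monomial ideal.\<close>

lemma gen_cancel_l:
  assumes \<tau>: "\<tau> \<in> subsets_of_size (n + 1) v" and i: "i \<in> \<tau>"
    and up: "\<forall>b b'. \<Phi> b \<longrightarrow> (\<forall>i\<in>\<tau>. b i \<le> b' i) \<longrightarrow> \<Phi> b'"
    and g: "g \<in> A" and lg: "l i * g \<in> gen \<Phi>"
  shows "g \<in> gen (\<lambda>b. \<Phi> (b(i := Suc (b i))))"
proof -
  have sub: "\<tau> \<subseteq> {1..v}" using \<tau> by (simp add: subsets_of_size_def)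
  obtain h where h1: "\<And>f. f \<in> A \<Longrightarrow> subst (\<lambda>j. if j \<in> \<tau> then l j else 0) (subst h f) = f"
    and h2: "\<And>j. j \<in> \<tau> \<Longrightarrow> subst h (l j) = var j"
    using coordinates[OF \<tau>] by blast
  have lgA: "l i * g \<in> A" using lg gen_closed by blast
  have "\<Phi> ((Poly_Mapping.lookup m)(i := Suc (Poly_Mapping.lookup m i)))"
    if m: "m \<in> Poly_Mapping.keys (subst h g)" for m
  proof -
    have "Poly_Mapping.single i 1 + m \<in> Poly_Mapping.keys (subst h (l i * g))"
      using m by (simp only: subst_mult h2[OF i] in_keys_iff lookup_single_mult) simp
    then have "\<Phi> (Poly_Mapping.lookup (Poly_Mapping.single i 1 + m))"
      using lg gen_iff_keys[OF sub h1 h2 up lgA] by blast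
    moreover have "Poly_Mapping.lookup (Poly_Mapping.single i 1 + m)
        = (Poly_Mapping.lookup m)(i := Suc (Poly_Mapping.lookup m i))"
      by (auto simp: fun_eq_iff lookup_add lookup_single when_def)
    ultimately show ?thesis by simp
  qed
  then show ?thesis
    by (subst gen_iff_keys[OF sub h1 h2 _ g]) (use up in auto)
qed

end

section \<open>Intersections over the bases of a matroid\<close>

text \<open>The dual form of the exchange axiom: the entering element is prescribed and the leaving
  one is found.\<close>

definition basis_exchange :: "nat set set \<Rightarrow> bool" where
  "basis_exchange C \<longleftrightarrow>
     (\<forall>\<sigma>\<in>C. \<forall>\<tau>\<in>C. \<forall>x\<in>\<tau> - \<sigma>. \<exists>j\<in>\<sigma> - \<tau>. insert x (\<sigma> - {j}) \<in> C)"

context generic_forms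
begin

text \<open>
  For \<open>T = {}\<close> and \<open>a = 0\<close> this says that the intersection of the ideals
  \<open>(l i : i \<in> \<sigma>)\<^sup>m\<close>, \<open>\<sigma> \<in> C\<close>, is spanned by products of the forms. Choosing \<open>i\<close> with \<open>a i\<close>
  minimal, restriction to \<open>l i = 0\<close> amounts to adding \<open>i\<close> to \<open>T\<close>, i.e. to contracting \<open>i\<close> in the
  matroid; minimality and basis exchange make the generators found there satisfy the conditions
  for all \<open>\<sigma>\<close>, so that they may be subtracted from \<open>f\<close> and the difference divided by \<open>l i\<close>.
\<close>

lemma Inter_gen:
  assumes C: "C \<subseteq> subsets_of_size n v" and exch: "basis_exchange C" and nv: "n < v"
    and "T \<subseteq> {1..v}" and "f \<in> A"
    and "\<And>\<sigma>. \<sigma> \<in> C \<Longrightarrow> T \<subseteq> \<sigma> \<Longrightarrow> f \<in> gen (\<lambda>b. (\<exists>i\<in>T. 0 < b i) \<or> m \<le> (\<Sum>i\<in>\<sigma>. a i + b i))"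
  shows "f \<in> gen (\<lambda>b. (\<exists>i\<in>T. 0 < b i) \<or> (\<forall>\<sigma>\<in>C. T \<subseteq> \<sigma> \<longrightarrow> m \<le> (\<Sum>i\<in>\<sigma>. a i + b i)))"
  using assms(4-6)
proof (induction "card ({1..v} - T)" arbitrary: T a f rule: less_induct)
  case outer: less
  let ?CT = "{\<sigma>\<in>C. T \<subseteq> \<sigma>}"
  have finC: "finite C"
    by (rule finite_subset[OF C]) (simp add: subsets_of_size_def)
  have C_sub: "\<sigma> \<subseteq> {1..v}" "finite \<sigma>" "card \<sigma> = n" if "\<sigma> \<in> C" for \<sigma>
    using that C by (auto simp: subsets_of_size_def intro: finite_subset)
  have swap: "\<exists>\<sigma>'\<in>C. T \<subseteq> \<sigma>' \<and> (\<exists>j\<in>\<sigma> - T. \<sigma>' = insert i (\<sigma> - {j}))"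
    if \<sigma>: "\<sigma> \<in> C" "T \<subseteq> \<sigma>" "i \<notin> \<sigma>" "i \<in> \<Union>?CT" for \<sigma> i
  proof -
    obtain \<tau> where \<tau>: "\<tau> \<in> C" "T \<subseteq> \<tau>" "i \<in> \<tau>" using \<sigma> by blast
    then obtain j where "j \<in> \<sigma> - \<tau>" "insert i (\<sigma> - {j}) \<in> C"
      using exch[unfolded basis_exchange_def, rule_format, of \<sigma> \<tau> i] \<sigma> by blast
    then show ?thesis using \<tau> \<sigma> by (intro bexI[of _ "insert i (\<sigma> - {j})"]) auto
  qed
  show ?case
    using outer.prems(2,3)
  \<comment> \<open>The measure is the total deficit of the bases containing \<open>T\<close>;
    raising \<open>a i\<close> records a factor \<open>l i\<close> that has been split off.\<close>
  proof (induction "\<Sum>\<sigma>\<in>?CT. m - (\<Sum>i\<in>\<sigma>. a i)" arbitrary: a f rule: less_induct)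
    case inner: less
    let ?\<Psi> = "\<lambda>b. (\<exists>i\<in>T. 0 < b i) \<or> (\<forall>\<sigma>\<in>C. T \<subseteq> \<sigma> \<longrightarrow> m \<le> (\<Sum>i\<in>\<sigma>. a i + b i))"
    show "f \<in> gen ?\<Psi>"
    proof (cases "\<forall>\<sigma>\<in>?CT. m \<le> (\<Sum>i\<in>\<sigma>. a i)")
      case True
      then show ?thesis using inner.prems(1) by (intro gen_unit) auto
    next
      case False
      then obtain \<sigma>0 where \<sigma>0: "\<sigma>0 \<in> C" "T \<subseteq> \<sigma>0" "(\<Sum>i\<in>\<sigma>0. a i) < m" by auto
      show ?thesis
      proof (cases "\<Union>?CT \<subseteq> T")
        case True
        \<comment> \<open>Every base containing \<open>T\<close> equals \<open>T\<close> here, so a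
          single condition remains, and it is a hypothesis.\<close>
        then have "\<sigma> = \<sigma>0" if "\<sigma> \<in> C" "T \<subseteq> \<sigma>" for \<sigma> using that \<sigma>0 by blast
        then show ?thesis using gen_mono[OF inner.prems(2)[OF \<sigma>0(1,2)], of ?\<Psi>] by blast
      next
        case False
        then obtain i where i: "i \<in> \<Union>?CT - T" and min: "\<And>j. j \<in> \<Union>?CT - T \<Longrightarrow> a i \<le> a j"
          using ex_has_least_nat[of "\<lambda>i. i \<in> \<Union>?CT - T" _ a] by blast
        have iV: "i \<in> {1..v}" using i C_sub by blast
        let ?\<Phi> = "\<lambda>b. (\<exists>k\<in>insert i T. 0 < b k) \<or> (\<forall>\<sigma>\<in>C. insert i T \<subseteq> \<sigma> \<longrightarrow> m \<le> (\<Sum>i\<in>\<sigma>. a i + b i))"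
        have "f \<in> gen ?\<Phi>"
        proof (rule outer.hyps)
          show "card ({1..v} - insert i T) < card ({1..v} - T)"
            using iV i by (intro psubset_card_mono) auto
          show "f \<in> gen (\<lambda>b. (\<exists>i\<in>insert i T. 0 < b i) \<or> m \<le> (\<Sum>i\<in>\<sigma>. a i + b i))"
            if "\<sigma> \<in> C" "insert i T \<subseteq> \<sigma>" for \<sigma>
            by (rule gen_mono[OF inner.prems(2)[of \<sigma>]]) (use that in auto)
        qed (use iV outer.prems inner.prems in auto)
        moreover have "0 < b i \<or> ?\<Psi> b" if \<Phi>: "?\<Phi> b" for b
        proof (rule ccontr)
          assume "\<not> ?thesis"
          then have b: "b i = 0" "\<not> (\<exists>k\<in>T. 0 < b k)"
            and "\<exists>\<sigma>\<in>C. T \<subseteq> \<sigma> \<and> \<not> m \<le> (\<Sum>i\<in>\<sigma>. a i + b i)" by auto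
          then obtain \<sigma> where \<sigma>: "\<sigma> \<in> C" "T \<subseteq> \<sigma>" "\<not> m \<le> (\<Sum>i\<in>\<sigma>. a i + b i)" by blast
          have le: "m \<le> (\<Sum>i\<in>\<sigma>. a i + b i)" if "\<sigma> \<in> C" "insert i T \<subseteq> \<sigma>" for \<sigma>
            using \<Phi> b that by auto
          then have "i \<notin> \<sigma>" using \<sigma> by auto
          then obtain \<sigma>' j where \<sigma>': "\<sigma>' \<in> C" "T \<subseteq> \<sigma>'" "j \<in> \<sigma> - T" "\<sigma>' = insert i (\<sigma> - {j})"
            using swap[of \<sigma> i] \<sigma> i by blast
          have "m \<le> (\<Sum>i\<in>\<sigma>'. a i + b i)" using le \<sigma>' by blast
          also have "\<dots> = a i + (\<Sum>k\<in>\<sigma> - {j}. a k + b k)"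
            using \<sigma>' b C_sub[OF \<sigma>(1)] \<open>i \<notin> \<sigma>\<close> by simp
          also have "\<dots> \<le> (a j + b j) + (\<Sum>k\<in>\<sigma> - {j}. a k + b k)"
            using min[of j] \<sigma> \<sigma>' by (intro add_right_mono trans_le_add1) blast
          also have "\<dots> = (\<Sum>i\<in>\<sigma>. a i + b i)"
            using \<sigma>' C_sub[OF \<sigma>(1)] by (simp add: sum.remove[of \<sigma> j])
          finally show False using \<sigma> by simp
        qed
        ultimately obtain h g where hg: "h \<in> gen ?\<Psi>" "g \<in> A" "f = h + l i * g"
          using gen_split[OF _ iV, of f ?\<Phi> ?\<Psi>] by blast
        let ?a = "a(i := Suc (a i))"
        have shift: "(\<Sum>k\<in>\<sigma>. a k + (b(i := Suc (b i))) k) = (\<Sum>k\<in>\<sigma>. ?a k + b k)"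
          for b :: "nat \<Rightarrow> nat" and \<sigma> by (rule sum.cong) auto
        have "g \<in> gen (\<lambda>b. (\<exists>i\<in>T. 0 < b i) \<or> (\<forall>\<sigma>\<in>C. T \<subseteq> \<sigma> \<longrightarrow> m \<le> (\<Sum>i\<in>\<sigma>. ?a i + b i)))"
        proof (rule inner.hyps)
          show "g \<in> A" by fact
        next
          fix \<sigma> assume \<sigma>: "\<sigma> \<in> C" "T \<subseteq> \<sigma>"
          let ?\<Phi>\<sigma> = "\<lambda>b. (\<exists>i\<in>T. 0 < b i) \<or> m \<le> (\<Sum>i\<in>\<sigma>. a i + b i)"
          have "h \<in> gen ?\<Phi>\<sigma>" by (rule gen_mono[OF hg(1)]) (use \<sigma> in blast)
          then have "l i * g \<in> gen ?\<Phi>\<sigma>"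
            using gen_diff[OF inner.prems(2)[OF \<sigma>], of h] hg by simp
          \<comment> \<open>\<sigma> and \<open>i\<close> fit into one coordinate system of n + 1
            forms; if \<open>i\<close> lies in \<sigma>, any further point, available by
            \<open>n < v\<close>, completes it.\<close>
          moreover obtain \<tau> where \<tau>: "\<tau> \<in> subsets_of_size (n + 1) v" "\<sigma> \<subseteq> \<tau>" "i \<in> \<tau>"
          proof -
            have "\<exists>x. x \<in> {1..v} - \<sigma>"
              using C_sub[OF \<sigma>(1)] nv card_mono[of \<sigma> "{1..v}"] by fastforce
            then obtain x where "x \<in> {1..v} - \<sigma>" "i \<in> insert x \<sigma>" using iV by (cases "i \<in> \<sigma>") auto
            then show ?thesis using C_sub[OF \<sigma>(1)]
              by (intro that[of "insert x \<sigma>"]) (auto simp: subsets_of_size_def)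
          qed
          moreover have "\<forall>b b'. ?\<Phi>\<sigma> b \<longrightarrow> (\<forall>i\<in>\<tau>. b i \<le> b' i) \<longrightarrow> ?\<Phi>\<sigma> b'"
          proof (intro allI impI)
            fix b b' assume b: "?\<Phi>\<sigma> b" and le: "\<forall>i\<in>\<tau>. b i \<le> b' i"
            have "(\<Sum>i\<in>\<sigma>. a i + b i) \<le> (\<Sum>i\<in>\<sigma>. a i + b' i)"
              using le \<tau>(2) by (intro sum_mono add_left_mono) auto
            moreover have "\<forall>i\<in>T. b i \<le> b' i" using le \<sigma>(2) \<tau>(2) by blast
            ultimately show "?\<Phi>\<sigma> b'" using b by (meson le_trans order_less_le_trans)
          qed
          ultimately have "g \<in> gen (\<lambda>b. ?\<Phi>\<sigma> (b(i := Suc (b i))))"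
            using gen_cancel_l[OF \<tau>(1,3), of ?\<Phi>\<sigma> g] hg(2) by blast
          then show "g \<in> gen (\<lambda>b. (\<exists>i\<in>T. 0 < b i) \<or> m \<le> (\<Sum>k\<in>\<sigma>. ?a k + b k))"
            unfolding shift by (rule gen_mono) (use i in \<open>auto split: if_splits\<close>)
        next
          \<comment> \<open>The measure falls if some deficient base contains \<open>i\<close>. When
            \<open>\<sigma>0\<close> does not, exchanging some \<open>j\<close> for \<open>i\<close>
            keeps the sum below \<open>m\<close>, since \<open>a i\<close> is minimal.\<close>
          obtain \<sigma>1 where \<sigma>1: "\<sigma>1 \<in> ?CT" "i \<in> \<sigma>1" "(\<Sum>i\<in>\<sigma>1. a i) < m"
          proof (cases "i \<in> \<sigma>0")
            case False
            then obtain \<sigma>' j where \<sigma>': "\<sigma>' \<in> C" "T \<subseteq> \<sigma>'" "j \<in> \<sigma>0 - T" "\<sigma>' = insert i (\<sigma>0 - {j})"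
              using swap[of \<sigma>0 i] \<sigma>0 i by blast
            have "(\<Sum>k\<in>\<sigma>'. a k) = a i + (\<Sum>k\<in>\<sigma>0 - {j}. a k)"
              using \<sigma>' C_sub[OF \<sigma>0(1)] False by simp
            also have "\<dots> \<le> a j + (\<Sum>k\<in>\<sigma>0 - {j}. a k)"
              using min[of j] \<sigma>0 \<sigma>' by (intro add_right_mono) blast
            also have "\<dots> = (\<Sum>k\<in>\<sigma>0. a k)"
              using \<sigma>' C_sub[OF \<sigma>0(1)] by (simp add: sum.remove[of \<sigma>0 j])
            finally have "(\<Sum>k\<in>\<sigma>'. a k) < m" using \<sigma>0 by linarith
            then show ?thesis using \<sigma>' by (intro that[of \<sigma>']) auto
          qed (use \<sigma>0 that in auto)
          have mono: "(\<Sum>k\<in>\<sigma>. a k) \<le> (\<Sum>k\<in>\<sigma>. ?a k)" for \<sigma>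
            by (rule sum_mono) simp
          have "(\<Sum>k\<in>\<sigma>1. a k) < (\<Sum>k\<in>\<sigma>1. ?a k)"
            using \<sigma>1 C_sub[of \<sigma>1] by (intro sum_strict_mono_ex1) auto
          then have "m - (\<Sum>k\<in>\<sigma>1. ?a k) < m - (\<Sum>k\<in>\<sigma>1. a k)" using \<sigma>1(3) by linarith
          then show "(\<Sum>\<sigma>\<in>?CT. m - (\<Sum>i\<in>\<sigma>. ?a i)) < (\<Sum>\<sigma>\<in>?CT. m - (\<Sum>i\<in>\<sigma>. a i))"
            using finC mono \<sigma>1(1) by (intro sum_strict_mono_ex1) (auto intro!: diff_le_mono2)
        qed
        then have "l i * g \<in> gen ?\<Psi>"
          by (rule gen_mult_l[OF _ iV]) (unfold shift, auto)
        then show ?thesis using gen_add[OF hg(1)] hg(3) by simp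
      qed
    qed
  qed
qed

end

section \<open>Powers of ideals\<close>

context cring
begin

lemma ideal_pow_Suc: "I [^]\<^bsub>ideals_set R\<^esub> Suc k = (I [^]\<^bsub>ideals_set R\<^esub> k) \<cdot> I"
  by (simp add: ideals_set_def)

lemma ideal_pow_0: "I [^]\<^bsub>ideals_set R\<^esub> (0::nat) = carrier R"
  by (simp add: ideals_set_def)

lemma ideal_pow: "ideal I R \<Longrightarrow> ideal (I [^]\<^bsub>ideals_set R\<^esub> (k::nat)) R"
  by (induction k) (simp_all only: ideal_pow_0 ideal_pow_Suc oneideal ideal_prod_is_ideal)

lemma ideal_pow_1: "ideal I R \<Longrightarrow> I [^]\<^bsub>ideals_set R\<^esub> (1::nat) = I"
  by (metis One_nat_def ideal_pow_0 ideal_pow_Suc ideal_prod_commute ideal_prod_one oneideal)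

lemma ideal_pow_add:
  assumes "ideal I R"
  shows "I [^]\<^bsub>ideals_set R\<^esub> (a + b :: nat) = (I [^]\<^bsub>ideals_set R\<^esub> a) \<cdot> (I [^]\<^bsub>ideals_set R\<^esub> b)"
proof -
  interpret M: comm_monoid "ideals_set R" by (rule ideals_set_is_comm_monoid)
  have "I \<in> carrier (ideals_set R)" using assms by (simp add: ideals_set_def)
  from M.nat_pow_mult[OF this, of a b] show ?thesis by (simp add: ideals_set_def)
qed

lemma ideal_pow_mult_mem:
  "ideal I R \<Longrightarrow> x \<in> I [^]\<^bsub>ideals_set R\<^esub> (a::nat) \<Longrightarrow> y \<in> I [^]\<^bsub>ideals_set R\<^esub> (b::nat)
    \<Longrightarrow> x \<otimes> y \<in> I [^]\<^bsub>ideals_set R\<^esub> (a + b)"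
  by (simp add: ideal_pow_add ideal_prod.prod)

lemma ideal_pow_antimono:
  assumes "ideal I R" "(a::nat) \<le> b"
  shows "I [^]\<^bsub>ideals_set R\<^esub> b \<subseteq> I [^]\<^bsub>ideals_set R\<^esub> a"
  using ideal_prod_inter[OF ideal_pow[OF assms(1), of a] ideal_pow[OF assms(1), of "b - a"]]
    ideal_pow_add[OF assms(1), of a "b - a"] assms(2) by auto

end

lemma ideal_mpoly_ring_iff:
  fixes I :: "'k::field mpoly set"
  shows "ideal I (mpoly_ring n) \<longleftrightarrow> I \<subseteq> carrier (mpoly_ring n) \<and> 0 \<in> I \<and>
     (\<forall>x\<in>I. \<forall>y\<in>I. x + y \<in> I) \<and> (\<forall>x\<in>I. \<forall>r\<in>carrier (mpoly_ring n). r * x \<in> I)"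
    (is "_ \<longleftrightarrow> ?rhs")
proof
  interpret R: cring "mpoly_ring n :: 'k mpoly ring" by (rule cring_mpoly_ring)
  show ?rhs if "ideal I (mpoly_ring n)"
  proof -
    interpret I: ideal I "mpoly_ring n" by fact
    show ?thesis using I.a_subset I.zero_closed I.a_closed I.I_l_closed by auto
  qed
  show "ideal I (mpoly_ring n)" if rhs: ?rhs
  proof (rule idealI)
    have minus: "\<ominus>\<^bsub>mpoly_ring n\<^esub> x = (- 1) * x" if "x \<in> carrier (mpoly_ring n)" for x :: "'k mpoly"
      using that by (intro R.minus_equality) auto
    show "subgroup I (add_monoid (mpoly_ring n))"
    proof (rule R.add.subgroupI)
      fix a assume a: "a \<in> I"
      have "- 1 \<in> carrier (mpoly_ring n :: 'k mpoly ring)" by auto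
      then have "(- 1) * a \<in> I" using rhs a by blast
      then show "\<ominus>\<^bsub>mpoly_ring n\<^esub> a \<in> I" using minus rhs a by auto
    qed (use rhs in auto)
  qed (use rhs in \<open>auto simp: R.ring_axioms mult.commute\<close>)
qed

context generic_forms
begin

sublocale R: cring "mpoly_ring n :: 'k mpoly ring" by (rule cring_mpoly_ring)

abbreviation ipow :: "'k mpoly set \<Rightarrow> nat \<Rightarrow> 'k mpoly set" where
  "ipow I k \<equiv> I [^]\<^bsub>ideals_set (mpoly_ring n)\<^esub> k"

lemma gen_ideal: "ideal (gen \<Phi>) (mpoly_ring n)"
  unfolding ideal_mpoly_ring_iff by (auto intro: gen_closed gen_zero gen_add gen_mult)

lemma gen_subset:
  assumes "ideal I (mpoly_ring n)" "\<And>b. \<Phi> b \<Longrightarrow> mon b \<in> I"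
  shows "gen \<Phi> \<subseteq> I"
proof
  fix f assume "f \<in> gen \<Phi>"
  then show "f \<in> I"
    using assms by induction (auto simp: ideal_mpoly_ring_iff)
qed

lemma gen_times:
  assumes "f \<in> gen \<Phi>" "g \<in> gen \<Psi>" "\<And>a b. \<Phi> a \<Longrightarrow> \<Psi> b \<Longrightarrow> \<Xi> (\<lambda>i. a i + b i)"
  shows "f * g \<in> gen \<Xi>"
  using assms(1)
proof induction
  case (gen_step r a f)
  have "mon a * g \<in> gen \<Xi>"
    using assms(2)
  proof induction
    case (gen_step s b g)
    then have "s * mon (\<lambda>i. a i + b i) + mon a * g \<in> gen \<Xi>"
      using assms(3) \<open>\<Phi> a\<close> by (intro gen.gen_step) auto
    then show ?case by (simp add: mon_add algebra_simps)
  qed (simp add: gen_zero)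
  then have "r * (mon a * g) + f * g \<in> gen \<Xi>"
    using gen_step by (intro gen_add gen_mult[of "mon a * g"]) auto
  then show ?case by (simp add: algebra_simps)
qed (simp add: gen_zero)

lemma ideal_prod_subset_gen:
  assumes "I \<subseteq> gen \<Phi>" "J \<subseteq> gen \<Psi>" "\<And>a b. \<Phi> a \<Longrightarrow> \<Psi> b \<Longrightarrow> \<Xi> (\<lambda>i. a i + b i)"
  shows "ideal_prod (mpoly_ring n) I J \<subseteq> gen \<Xi>"
proof
  fix f assume "f \<in> ideal_prod (mpoly_ring n) I J"
  then show "f \<in> gen \<Xi>"
  proof induction
    case (prod i j)
    then show ?case using gen_times[of i \<Phi> j \<Psi> \<Xi>] assms by auto
  next
    case (sum s1 s2)
    then show ?case by (simp add: gen_add)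
  qed
qed

lemma point_ideal_ideal: "\<sigma> \<subseteq> {1..v} \<Longrightarrow> ideal (point_ideal n l \<sigma>) (mpoly_ring n)"
  unfolding point_ideal_def using l_closed by (intro R.genideal_ideal) blast

lemma form_in_point_ideal: "\<sigma> \<subseteq> {1..v} \<Longrightarrow> i \<in> \<sigma> \<Longrightarrow> l i \<in> point_ideal n l \<sigma>"
  unfolding point_ideal_def using R.genideal_self[of "l ` \<sigma>"] l_closed by blast

lemma mon_indicator: "i \<in> {1..v} \<Longrightarrow> mon (\<lambda>j. if j = i then 1 else 0) = l i"
  by (simp add: mon_def prod.remove[of _ i])

text \<open>Each factor from the ideal contributes at least one form indexed by \<sigma>;
  conversely, the forms of \<open>mon b\<close> indexed by \<sigma> suffice, and the others are mere
  multipliers.\<close>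

lemma point_ideal_pow:
  assumes \<sigma>: "\<sigma> \<subseteq> {1..v}"
  shows "ipow (point_ideal n l \<sigma>) m = gen (\<lambda>b. m \<le> (\<Sum>i\<in>\<sigma>. b i))"
proof
  have fin: "finite \<sigma>" using \<sigma> finite_subset by blast
  let ?P = "point_ideal n l \<sigma>"
  note P = point_ideal_ideal[OF \<sigma>]
  show "ipow ?P m \<subseteq> gen (\<lambda>b. m \<le> (\<Sum>i\<in>\<sigma>. b i))"
  proof (induction m)
    case 0
    show ?case by (auto simp: ideals_set_def intro: gen_unit)
  next
    case (Suc m)
    have "?P \<subseteq> gen (\<lambda>b. 1 \<le> (\<Sum>i\<in>\<sigma>. b i))"
      unfolding point_ideal_def
    proof (rule R.genideal_minimal[OF gen_ideal], rule image_subsetI)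
      fix i assume i: "i \<in> \<sigma>"
      have "mon (\<lambda>j. if j = i then 1 else 0) \<in> gen (\<lambda>b. 1 \<le> (\<Sum>i\<in>\<sigma>. b i))"
        using i fin by (intro gen_mon) simp
      then show "l i \<in> gen (\<lambda>b. 1 \<le> (\<Sum>i\<in>\<sigma>. b i))" using i \<sigma> mon_indicator by auto
    qed
    then show ?case unfolding R.ideal_pow_Suc
      by (rule ideal_prod_subset_gen[OF Suc]) (simp add: sum.distrib)
  qed
  show "gen (\<lambda>b. m \<le> (\<Sum>i\<in>\<sigma>. b i)) \<subseteq> ipow ?P m"
  proof (rule gen_subset[OF R.ideal_pow[OF P]])
    fix b assume m: "m \<le> (\<Sum>i\<in>\<sigma>. b i)"
    have pow: "l i ^ e \<in> ipow ?P e" if "i \<in> \<sigma>" for i e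
    proof (induction e)
      case (Suc e)
      then show ?case
        using R.ideal_pow_mult_mem[OF P Suc, of "l i" 1] form_in_point_ideal[OF \<sigma> that]
        by (simp add: R.ideal_pow_1[OF P, simplified] mult.commute)
    qed (auto simp: ideals_set_def)
    have "(\<Prod>i\<in>S. l i ^ b i) \<in> ipow ?P (\<Sum>i\<in>S. b i)" if "S \<subseteq> \<sigma>" for S
      using finite_subset[OF that fin] that
    proof induction
      case (insert x S)
      then show ?case using R.ideal_pow_mult_mem[OF P pow[of x "b x"]] by simp
    qed (auto simp: ideals_set_def)
    then have "(\<Prod>i\<in>\<sigma>. l i ^ b i) \<in> ipow ?P m"
      using R.ideal_pow_antimono[OF P m] by blast
    moreover have "(\<Prod>i\<in>{1..v} - \<sigma>. l i ^ b i) \<in> A"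
      by (intro mpoly_ring_prod_closed mpoly_ring_closed l_closed) auto
    moreover have "mon b = (\<Prod>i\<in>{1..v} - \<sigma>. l i ^ b i) * (\<Prod>i\<in>\<sigma>. l i ^ b i)"
      unfolding mon_def by (rule prod.subset_diff[OF \<sigma>]) simp
    ultimately show "mon b \<in> ipow ?P m"
      using R.ideal_pow[OF P, of m] by (simp add: ideal_mpoly_ring_iff)
  qed
qed

lemma symbolic_power_eq_gen:
  assumes C: "C \<subseteq> subsets_of_size n v" and "basis_exchange C" "n < v"
  shows "config_symbolic_power n l C m = gen (\<lambda>b. \<forall>\<sigma>\<in>C. m \<le> (\<Sum>i\<in>\<sigma>. b i))"
proof -
  have sub: "\<sigma> \<subseteq> {1..v}" if "\<sigma> \<in> C" for \<sigma> using that C by (auto simp: subsets_of_size_def)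
  have "f \<in> gen (\<lambda>b. \<forall>\<sigma>\<in>C. m \<le> (\<Sum>i\<in>\<sigma>. b i))"
    if "f \<in> A" "\<And>\<sigma>. \<sigma> \<in> C \<Longrightarrow> f \<in> gen (\<lambda>b. m \<le> (\<Sum>i\<in>\<sigma>. b i))" for f
    using Inter_gen[OF assms, of "{}" f m "\<lambda>_. 0"] that by simp
  then show ?thesis
    unfolding config_symbolic_power_def
    by (auto simp: point_ideal_pow[OF sub] intro: gen_closed gen_mono)
qed

lemma config_ideal_eq_symbolic:
  assumes C: "C \<subseteq> subsets_of_size n v"
  shows "config_ideal n l C = config_symbolic_power n l C 1"
proof -
  have "\<sigma> \<subseteq> {1..v}" if "\<sigma> \<in> C" for \<sigma> using that C by (auto simp: subsets_of_size_def)
  then show ?thesis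
    unfolding config_ideal_def config_symbolic_power_def
    by (auto simp: R.ideal_pow_1[OF point_ideal_ideal, simplified])
qed

end

section \<open>Degrees\<close>

definition mon_deg :: "(nat \<Rightarrow>\<^sub>0 nat) \<Rightarrow> nat" where
  "mon_deg m = (\<Sum>i\<in>Poly_Mapping.keys m. Poly_Mapping.lookup m i)"

lemma mon_deg_add: "mon_deg (a + b) = mon_deg a + mon_deg b"
  unfolding mon_deg_def by (rule setsum_keys_plus_distrib) auto

lemma mon_deg_0 [simp]: "mon_deg 0 = 0"
  by (simp add: mon_deg_def)

lemma mon_deg_single: "mon_deg (Poly_Mapping.single i e) = e"
  by (cases "e = 0") (simp_all add: mon_deg_def)

text \<open>True of 0 for every \<open>d\<close>, so it can hold throughout an ideal; degrees are
  compared only for nonzero elements.\<close>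

definition order_ge :: "nat \<Rightarrow> 'k::field mpoly \<Rightarrow> bool" where
  "order_ge d p \<longleftrightarrow> (\<forall>m\<in>Poly_Mapping.keys p. d \<le> mon_deg m)"

lemma order_ge_add: "order_ge d p \<Longrightarrow> order_ge d q \<Longrightarrow> order_ge d (p + q)"
  unfolding order_ge_def by (blast dest: subsetD[OF Poly_Mapping.keys_add])

lemma order_ge_mult: "order_ge d p \<Longrightarrow> order_ge e q \<Longrightarrow> order_ge (d + e) (p * q)"
  unfolding order_ge_def
  by (fastforce dest: subsetD[OF keys_mult] simp: mon_deg_add intro: add_mono)

definition homogeneous :: "nat \<Rightarrow> 'k::field mpoly \<Rightarrow> bool" where
  "homogeneous d p \<longleftrightarrow> (\<forall>m\<in>Poly_Mapping.keys p. mon_deg m = d)"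

lemma homogeneous_1: "homogeneous 0 1"
  by (simp add: homogeneous_def)

lemma homogeneous_mult: "homogeneous d p \<Longrightarrow> homogeneous e q \<Longrightarrow> homogeneous (d + e) (p * q)"
  unfolding homogeneous_def by (fastforce dest: subsetD[OF keys_mult] simp: mon_deg_add)

lemma homogeneous_power: "homogeneous d p \<Longrightarrow> homogeneous (e * d) (p ^ e)"
  by (induction e) (auto simp: homogeneous_1 homogeneous_mult)

lemma homogeneous_prod:
  "(\<And>i. i \<in> S \<Longrightarrow> homogeneous (d i) (f i)) \<Longrightarrow> homogeneous (\<Sum>i\<in>S. d i) (\<Prod>i\<in>S. f i)"
  by (induction S rule: infinite_finite_induct) (auto simp: homogeneous_1 homogeneous_mult)

lemma homogeneous_linear: "linear_form n p \<Longrightarrow> homogeneous 1 p"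
  by (auto simp: linear_form_def homogeneous_def mon_deg_single)

lemma homogeneous_order_ge: "homogeneous d p \<Longrightarrow> p \<noteq> 0 \<Longrightarrow> order_ge e p \<Longrightarrow> e \<le> d"
  unfolding homogeneous_def order_ge_def using keys_eq_empty[of p] by fastforce

context generic_forms
begin

lemma mon_homogeneous: "homogeneous (\<Sum>i\<in>{1..v}. b i) (mon b)"
  unfolding mon_def
proof (rule homogeneous_prod)
  fix i assume "i \<in> {1..v}"
  from homogeneous_power[OF homogeneous_linear[OF linear[OF this]], of "b i"]
  show "homogeneous (b i) (l i ^ b i)" by simp
qed

text \<open>By \<open>n < v\<close> the index extends to n + 1 indices, whose family is
  independent.\<close>

lemma form_nonzero:
  assumes "n < v" "j \<in> {1..v}"
  shows "l j \<noteq> 0"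
proof
  assume zero: "l j = 0"
  obtain S where S: "S \<subseteq> {1..v} - {j}" "card S = n"
  proof -
    have "n \<le> card ({1..v} - {j})" using assms by simp
    then show ?thesis using obtain_subset_with_card_n that by metis
  qed
  then have "finite S" using finite_subset by blast
  then have "insert j S \<in> subsets_of_size (n + 1) v"
    using S assms by (auto simp: subsets_of_size_def card_insert_if)
  from indep[OF this] have "\<forall>c. (\<Sum>i\<in>insert j S. Poly_Mapping.single 0 (c i) * l i) = 0 \<longrightarrow> c j = 0"
    by (simp add: lin_indep_family_def)
  from spec[OF this, of "\<lambda>i. if i = j then 1 else 0"] show False
    using zero by (auto simp: sum.neutral)
qed

lemma mon_nonzero: "n < v \<Longrightarrow> mon b \<noteq> 0"
  unfolding mon_def using form_nonzero by auto

lemma gen_order_ge: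
  assumes "f \<in> gen \<Phi>" "\<And>b. \<Phi> b \<Longrightarrow> d \<le> (\<Sum>i\<in>{1..v}. b i)"
  shows "order_ge d f"
  using assms(1)
proof induction
  case (gen_step r b f)
  have "order_ge 0 r" by (simp add: order_ge_def)
  moreover have "order_ge d (mon b)"
    using mon_homogeneous[of b] assms(2)[OF gen_step(2)] by (simp add: homogeneous_def order_ge_def)
  ultimately have "order_ge (0 + d) (r * mon b)" by (rule order_ge_mult)
  with gen_step.IH show ?case by (simp add: order_ge_add)
qed (simp add: order_ge_def)

lemma ipow_order_ge:
  assumes "\<And>f. f \<in> I \<Longrightarrow> order_ge d f" "f \<in> ipow I r"
  shows "order_ge (r * d) f"
  using assms(2)
proof (induction r arbitrary: f)
  case (Suc r)
  have "order_ge (r * d + d) f" if "f \<in> ideal_prod (mpoly_ring n) (ipow I r) I" for f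
    using that
  proof induction
    case (prod i j)
    then show ?case using order_ge_mult[OF Suc.IH assms(1)] by simp
  next
    case (sum s1 s2)
    then show ?case by (simp add: order_ge_add)
  qed
  then show ?case using Suc.prems by (simp add: R.ideal_pow_Suc add.commute del: nat_pow_Suc)
qed (simp add: order_ge_def)

end

section \<open>Steiner systems\<close>

lemma subsets_of_sizeD:
  assumes "\<sigma> \<in> subsets_of_size k v"
  shows "\<sigma> \<subseteq> {1..v}" "finite \<sigma>" "card \<sigma> = k"
  using assms by (auto simp: subsets_of_size_def intro: finite_subset)

lemma subset_exchange:
  assumes "\<sigma> \<in> subsets_of_size k v" "j \<in> \<sigma>" "x \<in> {1..v} - \<sigma>"
  shows "insert x (\<sigma> - {j}) \<in> subsets_of_size k v"
proof -
  have "card (insert x (\<sigma> - {j})) = k"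
    using assms subsets_of_sizeD[OF assms(1)] card_Suc_Diff1[of \<sigma> j] by (simp add: card_insert_if)
  then show ?thesis using assms subsets_of_sizeD[OF assms(1)] by (auto simp: subsets_of_size_def)
qed

text \<open>Averaging without counting subsets: the largest value is at least the mean over
  \<open>n\<close> other elements, hence at least m / n, and its element can be removed.\<close>

lemma card_mult_le_sum:
  fixes f :: "'a \<Rightarrow> nat"
  assumes "finite S" "n \<le> card S" "\<And>\<sigma>. \<sigma> \<subseteq> S \<Longrightarrow> card \<sigma> = n \<Longrightarrow> m \<le> (\<Sum>i\<in>\<sigma>. f i)"
  shows "m * card S \<le> n * (\<Sum>i\<in>S. f i)"
  using assms
proof (induction "card S - n" arbitrary: S)
  case 0
  then show ?case by (metis diff_is_0_eq le_antisym mult.commute mult_le_mono2 order_refl)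
next
  case (Suc k)
  then have "S \<noteq> {}" by auto
  then obtain x where x: "x \<in> S" "\<And>y. y \<in> S \<Longrightarrow> f y \<le> f x"
  proof -
    have "Max (f ` S) \<in> f ` S" using Suc.prems(1) \<open>S \<noteq> {}\<close> by (intro Max_in) auto
    then obtain x where "x \<in> S" "f x = Max (f ` S)" by auto
    then show ?thesis using Suc.prems(1) by (intro that[of x]) auto
  qed
  have card: "card (S - {x}) = card S - 1" "n \<le> card (S - {x})"
    using x Suc by (auto simp: card_Diff_singleton)
  have IH: "m * card (S - {x}) \<le> n * (\<Sum>i\<in>S - {x}. f i)"
    using Suc card by (intro Suc.hyps(1)) auto
  obtain \<sigma> where \<sigma>: "\<sigma> \<subseteq> S - {x}" "card \<sigma> = n"
    by (rule obtain_subset_with_card_n[OF card(2)])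
  have "m \<le> (\<Sum>i\<in>\<sigma>. f i)" using Suc.prems(3) \<sigma> by blast
  also have "\<dots> \<le> n * f x" using sum_bounded_above[of \<sigma> f "f x"] \<sigma> x by auto
  finally have "m * card (S - {x}) + m \<le> n * (f x + (\<Sum>i\<in>S - {x}. f i))"
    using IH by (simp add: distrib_left)
  moreover have "card S = Suc (card (S - {x}))"
    by (rule card.remove[OF Suc.prems(1) x(1)])
  moreover have "(\<Sum>i\<in>S. f i) = f x + (\<Sum>i\<in>S - {x}. f i)"
    by (rule sum.remove[OF Suc.prems(1) x(1)])
  ultimately show ?case by (metis add.commute mult_Suc_right)
qed

locale steiner =
  fixes t n v :: nat and B :: "nat set set"
  assumes steiner: "steiner_system t n v B" and t_ge: "1 \<le> t" and t_less: "t < n" and n_less: "n < v"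
begin

definition "C = subsets_of_size n v - B"

lemma n_ge: "2 \<le> n"
  using t_ge t_less by simp

lemma C_subset: "C \<subseteq> subsets_of_size n v"
  by (auto simp: C_def)

lemma B_subset: "B \<subseteq> subsets_of_size n v"
  using steiner by (simp add: steiner_system_def)

lemma finite_B: "finite B"
  by (rule finite_subset[OF B_subset]) (simp add: subsets_of_size_def)

lemma block_exists: "T \<in> subsets_of_size t v \<Longrightarrow> \<exists>\<beta>\<in>B. T \<subseteq> \<beta>"
  using steiner unfolding steiner_system_def by blast

lemma block_unique:
  "T \<in> subsets_of_size t v \<Longrightarrow> \<beta> \<in> B \<Longrightarrow> \<beta>' \<in> B \<Longrightarrow> T \<subseteq> \<beta> \<Longrightarrow> T \<subseteq> \<beta>' \<Longrightarrow> \<beta> = \<beta>'"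
  using steiner unfolding steiner_system_def by blast

text \<open>Distinct blocks share fewer than \<open>t\<close> points, and t <= n - 1.\<close>

lemma card_block_Int:
  assumes "\<beta> \<in> B" "\<beta>' \<in> B" "\<beta> \<noteq> \<beta>'"
  shows "card (\<beta> \<inter> \<beta>') + 2 \<le> n"
proof (rule ccontr)
  assume "\<not> ?thesis"
  then have "t \<le> card (\<beta> \<inter> \<beta>')" using t_less by linarith
  then obtain T where T: "T \<subseteq> \<beta> \<inter> \<beta>'" "card T = t" using obtain_subset_with_card_n by metis
  then have "T \<in> subsets_of_size t v"
    using assms(1) B_subset by (auto simp: subsets_of_size_def)
  then show False using block_unique[of T \<beta> \<beta>'] T assms by blast
qed

text \<open>The new set shares n - 1 points with \<beta>, too many for two distinct blocks.\<close>

lemma exchange_block: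
  assumes "\<beta> \<in> B" "j \<in> \<beta>" "x \<in> {1..v} - \<beta>"
  shows "insert x (\<beta> - {j}) \<in> C"
proof -
  have \<beta>: "\<beta> \<in> subsets_of_size n v" using assms B_subset by blast
  note fin = subsets_of_sizeD[OF \<beta>]
  have "insert x (\<beta> - {j}) \<notin> B"
  proof
    assume "insert x (\<beta> - {j}) \<in> B"
    then have "card (\<beta> \<inter> insert x (\<beta> - {j})) + 2 \<le> n"
      using assms by (intro card_block_Int) auto
    moreover have "\<beta> \<inter> insert x (\<beta> - {j}) = \<beta> - {j}" using assms by auto
    ultimately show False using fin assms(2) by (simp add: card_Diff_singleton)
  qed
  then show ?thesis using subset_exchange[OF \<beta> assms(2,3)] by (simp add: C_def)
qed

text \<open>If every exchange failed, the sets \<open>insert x (\<sigma> - {j})\<close> would all be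
  blocks, but two of them differ by a single exchange. If there is only one \<open>j\<close>, the
  exchanged set is \<tau> itself.\<close>

lemma exchange_C: "basis_exchange C"
  unfolding basis_exchange_def
proof (intro ballI, rule ccontr)
  fix \<sigma> \<tau> x assume \<sigma>: "\<sigma> \<in> C" and \<tau>: "\<tau> \<in> C" and x: "x \<in> \<tau> - \<sigma>"
    and none: "\<not> (\<exists>j\<in>\<sigma> - \<tau>. insert x (\<sigma> - {j}) \<in> C)"
  have \<sigma>': "\<sigma> \<in> subsets_of_size n v" and \<tau>': "\<tau> \<in> subsets_of_size n v"
    using \<sigma> \<tau> C_subset by auto
  note f\<sigma> = subsets_of_sizeD[OF \<sigma>'] and f\<tau> = subsets_of_sizeD[OF \<tau>']
  have xV: "x \<in> {1..v} - \<sigma>" using x f\<tau> by blast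
  have B: "insert x (\<sigma> - {j}) \<in> B" if "j \<in> \<sigma> - \<tau>" for j
    using none that subset_exchange[OF \<sigma>' _ xV, of j] by (auto simp: C_def)
  have card_eq: "card (\<sigma> - \<tau>) = card (\<tau> - \<sigma>)"
    using f\<sigma> f\<tau> by (simp add: card_Diff_subset_Int Int_commute)
  have "\<sigma> - \<tau> \<noteq> {}" using card_eq x f\<tau>(2) by (metis card_gt_0_iff empty_iff finite_Diff less_irrefl)
  then obtain j where j: "j \<in> \<sigma> - \<tau>" by blast
  show False
  proof (cases "\<sigma> - \<tau> = {j}")
    case True
    then obtain y where y: "\<tau> - \<sigma> = {y}" using card_eq card_1_singletonE[of "\<tau> - \<sigma>"] by auto
    then have "insert x (\<sigma> - {j}) = \<tau>"
    proof -
      have "\<tau> - \<sigma> = {x}" using y x by simp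
      then have "\<tau> = (\<sigma> - (\<sigma> - \<tau>)) \<union> {x}" by blast
      then show ?thesis using True by simp
    qed
    then show False using B[OF j] \<tau> by (simp add: C_def)
  next
    case False
    then obtain k where k: "k \<in> \<sigma> - \<tau>" "k \<noteq> j" using j by blast
    let ?\<beta> = "insert x (\<sigma> - {j})"
    have "insert j (?\<beta> - {k}) \<in> C"
    proof (rule exchange_block[OF B[OF j]])
      show "k \<in> ?\<beta>" using k by auto
      show "j \<in> {1..v} - ?\<beta>" using j x f\<sigma> by auto
    qed
    moreover have "insert j (?\<beta> - {k}) = insert x (\<sigma> - {k})" using j k x by auto
    ultimately show False using B[OF k(1)] by (simp add: C_def)
  qed
qed

text \<open>A block and a second block through a point outside it share at most n - 2 points, so
  their union has at least n + 2.\<close>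

lemma v_ge: "n + 2 \<le> v"
proof -
  obtain T where T: "T \<subseteq> {1..v}" "card T = t"
    using obtain_subset_with_card_n[of t "{1..v}"] t_less n_less by auto
  then obtain \<beta> where \<beta>: "\<beta> \<in> B" using block_exists[of T] by (auto simp: subsets_of_size_def)
  then have f\<beta>: "\<beta> \<subseteq> {1..v}" "finite \<beta>" "card \<beta> = n" using B_subset subsets_of_sizeD by blast+
  then obtain x where x: "x \<in> {1..v}" "x \<notin> \<beta>"
    using n_less card_mono[of \<beta> "{1..v}"] by fastforce
  obtain S where S: "S \<subseteq> \<beta>" "card S = t - 1"
  proof -
    have "t - 1 \<le> card \<beta>" using f\<beta> t_less by simp
    then show ?thesis using obtain_subset_with_card_n that by metis
  qed
  then have "finite S" using f\<beta> finite_subset by blast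
  then have "insert x S \<in> subsets_of_size t v"
    using S x f\<beta> t_ge by (auto simp: subsets_of_size_def card_insert_if)
  then obtain \<beta>' where \<beta>': "\<beta>' \<in> B" "x \<in> \<beta>'" using block_exists by blast
  then have f\<beta>': "\<beta>' \<subseteq> {1..v}" "finite \<beta>'" "card \<beta>' = n" using B_subset subsets_of_sizeD by blast+
  have "card (\<beta> \<inter> \<beta>') + 2 \<le> n" using card_block_Int[OF \<beta> \<beta>'(1)] \<beta>'(2) x by blast
  moreover have "card (\<beta> \<union> \<beta>') \<le> v"
    using card_mono[of "{1..v}" "\<beta> \<union> \<beta>'"] f\<beta> f\<beta>' by auto
  ultimately show ?thesis
    using card_Un_Int[OF f\<beta>(2) f\<beta>'(2)] f\<beta> f\<beta>' by linarith
qed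

text \<open>(v - n) n - v = (v - n)(n - 1) - n >= n - 2, because v - n >= 2. The ratio (v - n) n / v
  is thus at least 1, so one unit of the symbolic exponent may be traded for one power of
  \<open>I\<close>.\<close>

lemma v_le: "v \<le> (v - n) * n"
proof -
  obtain k where k: "v = n + 2 + k" using v_ge le_Suc_ex by blast
  have "2 + k \<le> k * n + 2 + n" using n_ge by (cases n) auto
  moreover obtain j where "n = 2 + j" using n_ge le_Suc_ex by blast
  ultimately show ?thesis using k by (simp add: algebra_simps)
qed

section \<open>Counting blocks through a set\<close>

text \<open>For \<open>card K <= t\<close> this is the design parameter usually written lambda_i,
  where i = \<open>card K\<close>.\<close>

definition blocks_over :: "nat set \<Rightarrow> nat" where
  "blocks_over K = card {\<beta>\<in>B. K \<subseteq> \<beta>}"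

text \<open>Double counting of pairs consisting of a block over \<open>K\<close> and one of its
  points outside \<open>K\<close>.\<close>

lemma sum_blocks_over_insert:
  assumes "K \<subseteq> {1..v}"
  shows "(\<Sum>i\<in>{1..v} - K. blocks_over (insert i K)) = blocks_over K * (n - card K)"
proof -
  have "blocks_over (insert i K) = (\<Sum>\<beta>\<in>{\<beta>\<in>B. K \<subseteq> \<beta>}. if i \<in> \<beta> then 1 else 0)" for i
    unfolding blocks_over_def using finite_B
    by (subst sum.inter_filter[symmetric]) (auto intro!: arg_cong[of _ _ card])
  then have "(\<Sum>i\<in>{1..v} - K. blocks_over (insert i K))
      = (\<Sum>\<beta>\<in>{\<beta>\<in>B. K \<subseteq> \<beta>}. \<Sum>i\<in>{1..v} - K. if i \<in> \<beta> then 1 else 0)"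
    by (simp only:) (rule sum.swap)
  also have "\<dots> = (\<Sum>\<beta>\<in>{\<beta>\<in>B. K \<subseteq> \<beta>}. n - card K)"
  proof (rule sum.cong)
    fix \<beta> assume \<beta>: "\<beta> \<in> {\<beta>\<in>B. K \<subseteq> \<beta>}"
    then have f\<beta>: "\<beta> \<subseteq> {1..v}" "finite \<beta>" "card \<beta> = n" using B_subset subsets_of_sizeD by blast+
    have "(\<Sum>i\<in>{1..v} - K. if i \<in> \<beta> then 1 else 0) = card {i\<in>{1..v} - K. i \<in> \<beta>}"
      by (simp add: sum.inter_filter[symmetric])
    also have "{i\<in>{1..v} - K. i \<in> \<beta>} = \<beta> - K" using f\<beta> by auto
    also have "card \<dots> = n - card K"
      using \<beta> f\<beta> card_Diff_subset[of K \<beta>] finite_subset[of K \<beta>] by auto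
    finally show "(\<Sum>i\<in>{1..v} - K. if i \<in> \<beta> then 1 else 0) = n - card K" .
  qed simp
  finally show ?thesis by (simp add: blocks_over_def)
qed

text \<open>Downward induction from size \<open>t\<close>, where the count is 1; double counting
  determines the count for \<open>K\<close> from those for sets with one more point.\<close>

lemma blocks_over_eq:
  assumes "K \<subseteq> {1..v}" "K' \<subseteq> {1..v}" "card K = card K'" "card K \<le> t"
  shows "blocks_over K = blocks_over K'"
  using assms
proof (induction "t - card K" arbitrary: K K')
  case 0
  have "blocks_over K = 1" if "K \<subseteq> {1..v}" "card K = t" for K
  proof -
    have K: "K \<in> subsets_of_size t v" using that by (simp add: subsets_of_size_def)
    then obtain \<beta> where "\<beta> \<in> B" "K \<subseteq> \<beta>" using block_exists by blast
    then have "{\<beta>\<in>B. K \<subseteq> \<beta>} = {\<beta>}" using block_unique[OF K] by blast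
    then show ?thesis by (simp add: blocks_over_def)
  qed
  then show ?case using 0 by simp
next
  case (Suc k)
  have step: "blocks_over (insert i L) = blocks_over (insert j L')"
    if "L \<subseteq> {1..v}" "L' \<subseteq> {1..v}" "card L = card K" "card L' = card K" "i \<in> {1..v} - L" "j \<in> {1..v} - L'" for i j L L'
  proof -
    have fin: "finite L" "finite L'" using that finite_subset by blast+
    show ?thesis using that fin Suc.hyps(2) by (intro Suc.hyps(1)) auto
  qed
  have less: "card K < v" using Suc.prems t_less n_less by linarith
  then obtain i where i: "i \<in> {1..v} - K"
    using card_mono[of K "{1..v}"] finite_subset[OF Suc.prems(1)] by fastforce
  have sum: "(\<Sum>j\<in>{1..v} - L. blocks_over (insert j L)) = (v - card K) * blocks_over (insert i K)"
    if "L \<subseteq> {1..v}" "card L = card K" for L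
  proof -
    have "(\<Sum>j\<in>{1..v} - L. blocks_over (insert j L)) = (\<Sum>j\<in>{1..v} - L. blocks_over (insert i K))"
      using step[OF that(1) Suc.prems(1) that(2) refl] i by (intro sum.cong) auto
    then show ?thesis using that finite_subset[OF that(1)] by (simp add: card_Diff_subset)
  qed
  have "blocks_over K * (n - card K) = blocks_over K' * (n - card K)"
    using sum[OF Suc.prems(1) refl] sum[OF Suc.prems(2) Suc.prems(3)[symmetric]]
      sum_blocks_over_insert[OF Suc.prems(1)] sum_blocks_over_insert[OF Suc.prems(2)] Suc.prems(3)
    by metis
  moreover have "0 < n - card K" using Suc.prems t_less by simp
  ultimately show ?case by simp
qed

lemma blocks_over_insert:
  assumes "K \<subseteq> {1..v}" "card K < t" "i \<in> {1..v} - K"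
  shows "(v - card K) * blocks_over (insert i K) = blocks_over K * (n - card K)"
proof -
  have fin: "finite K" using assms finite_subset by blast
  have "(\<Sum>j\<in>{1..v} - K. blocks_over (insert j K)) = (\<Sum>j\<in>{1..v} - K. blocks_over (insert i K))"
    using assms fin by (intro sum.cong blocks_over_eq) auto
  then show ?thesis using sum_blocks_over_insert[OF assms(1)] assms fin by (simp add: card_Diff_subset)
qed

lemma blocks_over_pos:
  assumes "K \<subseteq> {1..v}" "card K \<le> t"
  shows "0 < blocks_over K"
proof -
  obtain T where "K \<subseteq> T" "T \<subseteq> {1..v}" "card T = t"
    using exists_subset_between[of K t "{1..v}"] assms t_less n_less by auto
  then obtain \<beta> where "\<beta> \<in> B" "K \<subseteq> \<beta>" using block_exists[of T] by (auto simp: subsets_of_size_def)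
  then show ?thesis using finite_B by (auto simp: blocks_over_def card_gt_0_iff)
qed

end

section \<open>Containments of symbolic powers\<close>

locale steiner_forms = steiner t n v B + generic_forms n v l
  for t n v :: nat and B :: "nat set set" and l :: "nat \<Rightarrow> 'k::field mpoly"
begin

definition "I = config_ideal n l C"

abbreviation "symb \<equiv> config_symbolic_power n l C"

lemma symb_eq: "symb m = gen (\<lambda>b. \<forall>\<sigma>\<in>C. m \<le> (\<Sum>i\<in>\<sigma>. b i))"
  by (rule symbolic_power_eq_gen[OF C_subset exchange_C n_less])

lemma I_eq: "I = gen (\<lambda>b. \<forall>\<sigma>\<in>C. 1 \<le> (\<Sum>i\<in>\<sigma>. b i))"
  unfolding I_def config_ideal_eq_symbolic[OF C_subset] symb_eq ..

lemma I_ideal: "ideal I (mpoly_ring n)"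
  unfolding I_eq by (rule gen_ideal)

section \<open>Noncontainment by degrees\<close>

text \<open>All n-subsets of the zero set of \<open>b\<close> must be blocks. With n + 1 zeros, two
  of these blocks would differ by a single exchange, so there are at most \<open>n\<close>
  zeros.\<close>

lemma I_order_ge:
  assumes "f \<in> I"
  shows "order_ge (v - n) f"
proof -
  have "v - n \<le> (\<Sum>i\<in>{1..v}. b i)" if b: "\<forall>\<sigma>\<in>C. 1 \<le> (\<Sum>i\<in>\<sigma>. b i)" for b :: "nat \<Rightarrow> nat"
  proof -
    let ?Z = "{i\<in>{1..v}. b i = 0}"
    have block: "\<sigma> \<in> B" if "\<sigma> \<subseteq> ?Z" "card \<sigma> = n" for \<sigma>
    proof (rule ccontr)
      assume "\<sigma> \<notin> B"
      then have "\<sigma> \<in> C" using that by (auto simp: C_def subsets_of_size_def)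
      then have "1 \<le> (\<Sum>i\<in>\<sigma>. b i)" using b by blast
      moreover have "(\<Sum>i\<in>\<sigma>. b i) = 0" using that(1) by (intro sum.neutral) auto
      ultimately show False by simp
    qed
    have "card ?Z \<le> n"
    proof (rule ccontr)
      assume "\<not> card ?Z \<le> n"
      then obtain \<tau> where \<tau>: "\<tau> \<subseteq> ?Z" "card \<tau> = n + 1"
        using obtain_subset_with_card_n[of "n + 1" ?Z] by auto
      then have fin: "finite \<tau>" by (metis card.infinite nat.distinct(1) Suc_eq_plus1)
      obtain x where x: "x \<in> \<tau>" using \<tau> by fastforce
      have \<beta>: "\<tau> - {x} \<in> B" using block[of "\<tau> - {x}"] \<tau> x fin by auto
      have "\<tau> - {x} \<noteq> {}" using \<beta> B_subset n_ge by (fastforce simp: subsets_of_size_def)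
      then obtain y where y: "y \<in> \<tau>" "y \<noteq> x" by blast
      have "insert x (\<tau> - {x} - {y}) \<in> C"
        using \<tau> x y by (intro exchange_block[OF \<beta>]) auto
      moreover have "insert x (\<tau> - {x} - {y}) = \<tau> - {y}" using x y by auto
      moreover have "\<tau> - {y} \<in> B" using block[of "\<tau> - {y}"] \<tau> y fin by auto
      ultimately show False by (simp add: C_def)
    qed
    then have "v - n \<le> card ({1..v} - ?Z)" by (subst card_Diff_subset) auto
    also have "\<dots> \<le> (\<Sum>i\<in>{1..v} - ?Z. b i)"
    proof -
      have "1 \<le> b i" if "i \<in> {1..v} - ?Z" for i using that by auto
      from sum_bounded_below[of "{1..v} - ?Z" 1 b, OF this] show ?thesis by simp
    qed
    also have "\<dots> \<le> (\<Sum>i\<in>{1..v}. b i)" by (rule sum_mono2) auto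
    finally show ?thesis .
  qed
  with assms show ?thesis unfolding I_eq by (rule gen_order_ge)
qed

lemma symb_not_subset:
  assumes "m \<le> n * j" "j * v < r * (v - n)"
  shows "\<not> symb m \<subseteq> ipow I r"
proof
  assume sub: "symb m \<subseteq> ipow I r"
  have "m \<le> (\<Sum>i\<in>\<sigma>. j)" if "\<sigma> \<in> C" for \<sigma>
    using that C_subset assms(1) subsets_of_sizeD(3)[of \<sigma> n v] by auto
  then have "mon (\<lambda>_. j) \<in> symb m" unfolding symb_eq by (intro gen_mon) auto
  then have "order_ge (r * (v - n)) (mon (\<lambda>_. j))"
    using sub ipow_order_ge[OF I_order_ge] by blast
  then have "r * (v - n) \<le> (\<Sum>i\<in>{1..v}. j)"
    by (rule homogeneous_order_ge[OF mon_homogeneous mon_nonzero[OF n_less]])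
  then show False using assms(2) by (simp add: mult.commute)
qed

section \<open>Exponent vectors in powers of the ideal\<close>

lemma ipow_mult: "f \<in> A \<Longrightarrow> g \<in> ipow I r \<Longrightarrow> f * g \<in> ipow I r"
  using R.ideal_pow[OF I_ideal, of r] by (simp add: ideal_mpoly_ring_iff)

lemma ipow_zero: "f \<in> A \<Longrightarrow> f \<in> ipow I 0"
  by (simp add: ideals_set_def)

lemma ipow_antimono: "r \<le> s \<Longrightarrow> f \<in> ipow I s \<Longrightarrow> f \<in> ipow I r"
  using R.ideal_pow_antimono[OF I_ideal] by blast

lemma mon_ipow_mono:
  assumes "mon a \<in> ipow I r" "\<And>i. i \<in> {1..v} \<Longrightarrow> a i \<le> b i"
  shows "mon b \<in> ipow I r"
proof -
  have "mon b = mon (\<lambda>i. (b i - a i) + a i)"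
    unfolding mon_def using assms(2) by (intro prod.cong) auto
  then show ?thesis using ipow_mult[OF mon_closed assms(1)] by (simp only: mon_add)
qed

lemma mon_ipow_add: "mon a \<in> ipow I p \<Longrightarrow> mon b \<in> ipow I q \<Longrightarrow> mon (\<lambda>i. a i + b i) \<in> ipow I (p + q)"
  using R.ideal_pow_mult_mem[OF I_ideal, of "mon a" p "mon b" q] by (simp add: mon_add)

lemma mon_ipow_power:
  assumes "mon a \<in> ipow I p"
  shows "mon (\<lambda>i. q * a i) \<in> ipow I (q * p)"
proof (induction q)
  case 0
  show ?case using ipow_zero[OF mon_closed] by simp
next
  case (Suc q)
  show ?case using mon_ipow_add[OF assms Suc] by simp
qed

lemma mon_ipow_I: "mon a \<in> I \<Longrightarrow> mon a \<in> ipow I 1"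
  using R.ideal_pow_1[OF I_ideal] by simp

text \<open>\<beta> is the only n-subset inside \<beta>, and it is not in \<open>C\<close>. These
  generators attain the least degree v - n.\<close>

lemma mon_block_in_I:
  assumes "\<beta> \<in> B"
  shows "mon (\<lambda>i. if i \<in> \<beta> then 0 else 1) \<in> I"
  unfolding I_eq
proof (rule gen_mon, intro ballI)
  fix \<sigma> assume \<sigma>: "\<sigma> \<in> C"
  then have f: "finite \<sigma>" "card \<sigma> = n" using C_subset subsets_of_sizeD by blast+
  have \<beta>: "finite \<beta>" "card \<beta> = n" using assms B_subset subsets_of_sizeD by blast+
  have "\<not> \<sigma> \<subseteq> \<beta>" using card_subset_eq[OF \<beta>(1), of \<sigma>] f \<beta> assms \<sigma> by (auto simp: C_def)
  then obtain x where "x \<in> \<sigma>" "x \<notin> \<beta>" by blast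
  then show "1 \<le> (\<Sum>i\<in>\<sigma>. if i \<in> \<beta> then 0 else 1 :: nat)"
    using member_le_sum[of x \<sigma> "\<lambda>i. if i \<in> \<beta> then 0 else 1 :: nat"] f by simp
qed

text \<open>No n-subset fits into \<open>K\<close>. With n - 1 points in \<open>K\<close> the degree
  is v - n + 1.\<close>

lemma mon_small_in_I:
  assumes "finite K" "card K < n"
  shows "mon (\<lambda>i. if i \<in> K then 0 else 1) \<in> I"
  unfolding I_eq
proof (rule gen_mon, intro ballI)
  fix \<sigma> assume \<sigma>: "\<sigma> \<in> C"
  then have f: "finite \<sigma>" "card \<sigma> = n" using C_subset subsets_of_sizeD by blast+
  have "\<not> \<sigma> \<subseteq> K" using card_mono[OF assms(1), of \<sigma>] f assms by auto
  then obtain x where "x \<in> \<sigma>" "x \<notin> K" by blast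
  then show "1 \<le> (\<Sum>i\<in>\<sigma>. if i \<in> K then 0 else 1 :: nat)"
    using member_le_sum[of x \<sigma> "\<lambda>i. if i \<in> K then 0 else 1 :: nat"] f by simp
qed

text \<open>
  At most one block \<open>\<beta>\<close> can have exponent sum less than \<open>m\<close>; then every exponent outside \<open>\<beta>\<close>
  exceeds those in \<open>\<beta>\<close> by \<open>p = m - (\<Sum>i\<in>\<beta>. b i)\<close>, and dividing by the \<open>p\<close>-th power of the
  generator belonging to \<open>\<beta>\<close> leaves a product in the symbolic power \<open>m - p\<close> of the full star
  configuration.
\<close>

lemma mon_star_reduction:
  assumes b: "\<forall>\<sigma>\<in>C. m \<le> (\<Sum>i\<in>\<sigma>. b i)"
  obtains p a b' where "p \<le> m" "mon a \<in> ipow I p" "\<And>i. i \<in> {1..v} \<Longrightarrow> b i = a i + b' i"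
    "\<And>\<sigma>. \<sigma> \<in> subsets_of_size n v \<Longrightarrow> m - p \<le> (\<Sum>i\<in>\<sigma>. b' i)"
proof (cases "\<forall>\<sigma>\<in>subsets_of_size n v. m \<le> (\<Sum>i\<in>\<sigma>. b i)")
  case True
  then show ?thesis
    using ipow_zero[OF mon_closed] by (intro that[of 0 "\<lambda>_. 0" b]) auto
next
  case False
  then obtain \<beta> where \<beta>: "\<beta> \<in> subsets_of_size n v" "(\<Sum>i\<in>\<beta>. b i) < m" by fastforce
  note f\<beta> = subsets_of_sizeD[OF \<beta>(1)]
  have \<beta>B: "\<beta> \<in> B" using \<beta> b by (force simp: C_def)
  define p where "p = m - (\<Sum>i\<in>\<beta>. b i)"
  have gap: "p + b j \<le> b x" if "j \<in> \<beta>" "x \<in> {1..v} - \<beta>" for j x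
  proof -
    have "m \<le> (\<Sum>i\<in>insert x (\<beta> - {j}). b i)"
      using exchange_block[OF \<beta>B that] b by blast
    also have "\<dots> = b x + (\<Sum>i\<in>\<beta> - {j}. b i)" using that f\<beta> by simp
    finally have "m + b j \<le> b x + (\<Sum>i\<in>\<beta>. b i)"
      using sum.remove[OF f\<beta>(2) that(1), of b] by linarith
    then show ?thesis using \<beta>(2) by (simp add: p_def)
  qed
  have "\<beta> \<noteq> {}" using f\<beta> n_ge by auto
  let ?a = "\<lambda>i. p * (if i \<in> \<beta> then 0 else 1)" and ?b' = "\<lambda>i. if i \<in> \<beta> then b i else b i - p"
  \<comment> \<open>By \<open>gap\<close>, \<open>c\<close> separates the exponents
    \<open>?b'\<close> in \<beta> from those outside, so \<beta> has the least sum among all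
    n-subsets, namely m - p.\<close>
  define c where "c = Max (b ` \<beta>)"
  have c_ge: "b j \<le> c" if "j \<in> \<beta>" for j using that f\<beta> by (simp add: c_def)
  have "c \<in> b ` \<beta>" unfolding c_def using f\<beta> \<open>\<beta> \<noteq> {}\<close> by (intro Max_in) auto
  then have c_le: "c \<le> b x - p" if "x \<in> {1..v} - \<beta>" for x using gap that by fastforce
  show ?thesis
  proof (rule that[of p ?a ?b'])
    show "p \<le> m" by (simp add: p_def)
    show "mon ?a \<in> ipow I p"
      using mon_ipow_power[OF mon_ipow_I[OF mon_block_in_I[OF \<beta>B]], of p] by simp
    show "b i = ?a i + ?b' i" if "i \<in> {1..v}" for i
    proof -
      obtain j where "j \<in> \<beta>" using \<open>\<beta> \<noteq> {}\<close> by blast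
      then show ?thesis using gap[of j i] that by auto
    qed
    show "m - p \<le> (\<Sum>i\<in>\<sigma>. ?b' i)" if \<sigma>: "\<sigma> \<in> subsets_of_size n v" for \<sigma>
    proof -
      note f\<sigma> = subsets_of_sizeD[OF \<sigma>]
      have card_eq: "card (\<sigma> - \<beta>) = card (\<beta> - \<sigma>)"
        using f\<sigma> f\<beta> by (simp add: card_Diff_subset_Int Int_commute)
      have "m - p = (\<Sum>i\<in>\<beta>. b i)" using \<beta>(2) by (simp add: p_def)
      also have "\<dots> = (\<Sum>i\<in>\<beta> \<inter> \<sigma>. b i) + (\<Sum>i\<in>\<beta> - \<sigma>. b i)"
        using f\<beta>(2) by (rule sum.Int_Diff)
      also have "(\<Sum>i\<in>\<beta> - \<sigma>. b i) \<le> card (\<beta> - \<sigma>) * c"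
        using sum_bounded_above[of "\<beta> - \<sigma>" b c] c_ge by simp
      also have "card (\<beta> - \<sigma>) * c \<le> (\<Sum>i\<in>\<sigma> - \<beta>. b i - p)"
        using sum_bounded_below[of "\<sigma> - \<beta>" c "\<lambda>i. b i - p"] c_le f\<sigma>(1) by (simp add: card_eq subset_iff)
      also have "(\<Sum>i\<in>\<beta> \<inter> \<sigma>. b i) + (\<Sum>i\<in>\<sigma> - \<beta>. b i - p) = (\<Sum>i\<in>\<sigma>. ?b' i)"
        using f\<sigma>(2) by (subst sum.Int_Diff[of \<sigma> _ \<beta>]) (auto simp: Int_commute intro!: sum.cong arg_cong2[of _ _ _ _ "(+)"])
      finally show ?thesis by simp
    qed
  qed
qed

text \<open>A criterion of Gale-Ryser type, proved greedily: \<open>b\<close> then dominates a sum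
  of \<open>r\<close> indicators of sets with v - n + 1 points. Their complements have n - 1 points,
  so each indicator yields a factor in \<open>I\<close>.\<close>

lemma mon_in_ipow_if_sum_min:
  assumes "r * (v - n + 1) \<le> (\<Sum>i\<in>{1..v}. min (b i) r)"
  shows "mon b \<in> ipow I r"
  using assms
proof (induction r arbitrary: b)
  case 0
  show ?case by (rule ipow_zero[OF mon_closed])
next
  case (Suc r)
  let ?w = "v - n + 1" and ?P = "{i\<in>{1..v}. Suc r \<le> b i}" and ?Q = "{i\<in>{1..v}. 0 < b i}"
  have step: ?case if U: "U \<subseteq> ?Q" "card U = ?w"
    and ge: "r * ?w \<le> (\<Sum>i\<in>{1..v}. min (if i \<in> U then b i - 1 else b i) r)" for U
  proof -
    let ?K = "{1..v} - U"
    have U': "U \<subseteq> {1..v}" "finite U" using U finite_subset[of U ?Q] by auto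
    have "card ?K < n" using U U' n_ge n_less by (simp add: card_Diff_subset)
    then have "mon (\<lambda>i. if i \<in> ?K then 0 else 1) \<in> ipow I 1"
      by (intro mon_ipow_I mon_small_in_I) auto
    from mon_ipow_add[OF this Suc.IH[OF ge]]
    have "mon (\<lambda>i. (if i \<in> ?K then 0 else 1) + (if i \<in> U then b i - 1 else b i)) \<in> ipow I (Suc r)"
      by simp
    then show ?thesis by (rule mon_ipow_mono) (use U in auto)
  qed
  show ?case
  proof (cases "?w \<le> card ?P")
    case True
    then obtain U where U: "U \<subseteq> ?P" "card U = ?w" by (rule obtain_subset_with_card_n)
    \<comment> \<open>The points of \<open>U\<close> still reach the cap \<open>r\<close> after the
      decrement and alone provide the required sum.\<close>
    have "r * ?w = (\<Sum>i\<in>U. min (b i - 1) r)"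
    proof -
      have "(\<Sum>i\<in>U. min (b i - 1) r) = (\<Sum>i\<in>U. r)" using U by (intro sum.cong) auto
      then show ?thesis using U by simp
    qed
    also have "\<dots> = (\<Sum>i\<in>U. min (if i \<in> U then b i - 1 else b i) r)" by simp
    also have "\<dots> \<le> (\<Sum>i\<in>{1..v}. min (if i \<in> U then b i - 1 else b i) r)"
      using U by (intro sum_mono2) auto
    finally show ?thesis using U by (intro step) auto
  next
    case False
    have "Suc r * ?w \<le> (\<Sum>i\<in>{1..v}. if 0 < b i then Suc r else 0)"
      using Suc.prems by (rule order_trans) (auto intro!: sum_mono)
    also have "\<dots> = Suc r * card ?Q"
      by (simp add: sum.inter_filter[symmetric])
    finally have "?w \<le> card ?Q" by (metis Suc_mult_le_cancel1)
    moreover have "?P \<subseteq> ?Q" by auto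
    \<comment> \<open>At the points of \<open>?P\<close>, lowering the cap from \<open>Suc r\<close>
      to \<open>r\<close> loses one unit anyway, so \<open>U\<close> has to contain them; the capped
      sum then drops by exactly \<open>?w\<close>.\<close>
    ultimately obtain U where U: "?P \<subseteq> U" "U \<subseteq> ?Q" "card U = ?w"
      using exists_subset_between[of ?P ?w ?Q] False by auto
    have "min (if i \<in> U then b i - 1 else b i) r + (if i \<in> U then 1 else 0) = min (b i) (Suc r)"
      if "i \<in> {1..v}" for i
      using that U by (cases "i \<in> U") (auto simp: min_def)
    then have "(\<Sum>i\<in>{1..v}. min (if i \<in> U then b i - 1 else b i) r) + (\<Sum>i\<in>{1..v}. if i \<in> U then 1 else 0)
        = (\<Sum>i\<in>{1..v}. min (b i) (Suc r))"
      by (simp flip: sum.distrib)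
    moreover have "(\<Sum>i\<in>{1..v}. if i \<in> U then 1 else 0) = ?w"
    proof -
      have "{i\<in>{1..v}. i \<in> U} = U" using U by auto
      then show ?thesis using U(3) by (simp add: sum.inter_filter[symmetric])
    qed
    ultimately show ?thesis using Suc.prems U by (intro step[of U]) auto
  qed
qed

text \<open>Cap the exponents at \<open>r\<close>. If fewer than \<open>n\<close> of them are below
  \<open>r\<close>, the others suffice; otherwise the small ones have mean at least m / n.\<close>

lemma mon_star_in_ipow:
  assumes b: "\<And>\<sigma>. \<sigma> \<in> subsets_of_size n v \<Longrightarrow> m \<le> (\<Sum>i\<in>\<sigma>. b i)"
    and m: "r * (v - n + 1) * n \<le> m * v"
  shows "mon b \<in> ipow I r"
proof (rule mon_in_ipow_if_sum_min)
  let ?S = "{i\<in>{1..v}. b i < r}"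
  let ?s = "card ?S"
  have "?s \<le> card {1..v}" by (intro card_mono) auto
  then have s_le: "?s \<le> v" by simp
  have "(\<Sum>i\<in>{1..v}. min (b i) r) = (\<Sum>i\<in>{1..v} - ?S. min (b i) r) + (\<Sum>i\<in>?S. min (b i) r)"
    by (rule sum.subset_diff) auto
  moreover have "(\<Sum>i\<in>{1..v} - ?S. min (b i) r) = (\<Sum>i\<in>{1..v} - ?S. r)" by (intro sum.cong) auto
  moreover have "(\<Sum>i\<in>{1..v} - ?S. r) = (v - ?s) * r"
  proof -
    have "card ({1..v} - ?S) = v - ?s" by (subst card_Diff_subset) auto
    then show ?thesis by simp
  qed
  moreover have "(\<Sum>i\<in>?S. min (b i) r) = (\<Sum>i\<in>?S. b i)" by (intro sum.cong) auto
  ultimately have eq: "(\<Sum>i\<in>{1..v}. min (b i) r) = (v - ?s) * r + (\<Sum>i\<in>?S. b i)" by simp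
  show "r * (v - n + 1) \<le> (\<Sum>i\<in>{1..v}. min (b i) r)"
  proof (cases "n \<le> ?s")
    case False
    then have "v - n + 1 \<le> v - ?s" using n_less by linarith
    then have "r * (v - n + 1) \<le> r * (v - ?s)" by (rule mult_le_mono2)
    then show ?thesis unfolding eq by (simp add: mult.commute)
  next
    case True
    have "m * ?s \<le> n * (\<Sum>i\<in>?S. b i)"
    proof (rule card_mult_le_sum)
      fix \<sigma> assume "\<sigma> \<subseteq> ?S" "card \<sigma> = n"
      then have "\<sigma> \<in> subsets_of_size n v" by (auto simp: subsets_of_size_def)
      then show "m \<le> (\<Sum>i\<in>\<sigma>. b i)" by (rule b)
    qed (use True in auto)
    then have *: "m * ?s * v \<le> n * (\<Sum>i\<in>?S. b i) * v" by (rule mult_le_mono1)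
    have **: "r * (v - n + 1) * n * ?s \<le> m * v * ?s" using m by (rule mult_le_mono1)
    \<comment> \<open>v - n + 1 is at most the mean of \<open>v\<close> and v - n + 1 with weights
      \<open>v - ?s\<close> and \<open>?s\<close>.\<close>
    have "(v - n + 1) * v \<le> (v - ?s) * v + (v - n + 1) * ?s"
    proof -
      obtain d where d: "v = ?s + d" using s_le le_Suc_ex by blast
      have "(v - n + 1) * d \<le> v * d" using n_ge n_less by (intro mult_le_mono1) simp
      moreover have "(v - n + 1) * v = (v - n + 1) * ?s + (v - n + 1) * d"
        using arg_cong[OF d, of "\<lambda>x. (v - n + 1) * x"] by (simp only: distrib_left)
      moreover have "v * d = (v - ?s) * v" using d by (metis add_diff_cancel_left' mult.commute)
      ultimately show ?thesis by linarith
    qed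
    then have "(n * r) * ((v - n + 1) * v) \<le> (n * r) * ((v - ?s) * v + (v - n + 1) * ?s)"
      by (rule mult_le_mono2)
    also have "\<dots> = n * ((v - ?s) * r) * v + r * (v - n + 1) * n * ?s" by (simp add: algebra_simps)
    also have "\<dots> \<le> n * ((v - ?s) * r) * v + n * (\<Sum>i\<in>?S. b i) * v"
    proof -
      have "m * v * ?s = m * ?s * v" by (simp only: mult_ac)
      then show ?thesis using * ** by linarith
    qed
    also have "(n * r) * ((v - n + 1) * v) = (n * v) * (r * (v - n + 1))" by (simp only: mult_ac)
    also have "n * ((v - ?s) * r) * v + n * (\<Sum>i\<in>?S. b i) * v = (n * v) * ((v - ?s) * r + (\<Sum>i\<in>?S. b i))"
      by (simp only: distrib_left mult_ac)
    finally have "(n * v) * (r * (v - n + 1)) \<le> (n * v) * ((v - ?s) * r + (\<Sum>i\<in>?S. b i))" .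
    moreover have "0 < n * v" using n_ge n_less by simp
    ultimately show ?thesis unfolding eq by (simp only: mult_le_cancel1)
  qed
qed

lemma symb_subset:
  assumes m: "r * (v - n + 1) * n \<le> m * v"
  shows "symb m \<subseteq> ipow I r"
  unfolding symb_eq
proof (rule gen_subset[OF R.ideal_pow[OF I_ideal]])
  fix b :: "nat \<Rightarrow> nat" assume "\<forall>\<sigma>\<in>C. m \<le> (\<Sum>i\<in>\<sigma>. b i)"
  then obtain p a b' where p: "p \<le> m" "mon a \<in> ipow I p"
    and b: "\<And>i. i \<in> {1..v} \<Longrightarrow> b i = a i + b' i"
    and b': "\<And>\<sigma>. \<sigma> \<in> subsets_of_size n v \<Longrightarrow> m - p \<le> (\<Sum>i\<in>\<sigma>. b' i)"
    using mon_star_reduction by metis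
  \<comment> \<open>The \<open>p\<close> stripped generators lower both exponents by
    \<open>p\<close>; by \<open>v_le\<close> the inequality survives.\<close>
  have "(r - p) * (v - n + 1) * n \<le> (m - p) * v"
  proof -
    have "p * v \<le> p * ((v - n + 1) * n)"
      using v_le by (intro mult_le_mono2) (simp add: algebra_simps)
    then show ?thesis using m by (simp only: diff_mult_distrib mult.assoc)
  qed
  with b' have "mon b' \<in> ipow I (r - p)" by (rule mon_star_in_ipow)
  from mon_ipow_add[OF p(2) this] have "mon (\<lambda>i. a i + b' i) \<in> ipow I (p + (r - p))" .
  then have "mon (\<lambda>i. a i + b' i) \<in> ipow I r" by (rule ipow_antimono[rotated]) simp
  then show "mon b \<in> ipow I r" by (rule mon_ipow_mono) (simp add: b)
qed

section \<open>Sharper containments for t = n - 1\<close>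

lemma mon_blocks_in_ipow:
  assumes "finite F" "F \<subseteq> B"
  shows "mon (\<lambda>i. card {\<beta>\<in>F. i \<notin> \<beta>}) \<in> ipow I (card F)"
  using assms
proof induction
  case empty
  show ?case using ipow_zero[OF mon_closed] by simp
next
  case (insert \<beta> F)
  have "card {\<gamma>\<in>insert \<beta> F. i \<notin> \<gamma>} = (if i \<in> \<beta> then 0 else 1) + card {\<gamma>\<in>F. i \<notin> \<gamma>}" for i
  proof (cases "i \<in> \<beta>")
    case False
    then have "{\<gamma>\<in>insert \<beta> F. i \<notin> \<gamma>} = insert \<beta> {\<gamma>\<in>F. i \<notin> \<gamma>}" by auto
    then show ?thesis using insert False by simp
  next
    case True
    then have "{\<gamma>\<in>insert \<beta> F. i \<notin> \<gamma>} = {\<gamma>\<in>F. i \<notin> \<gamma>}" by auto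
    then show ?thesis using True by simp
  qed
  then show ?case
    using mon_ipow_add[OF mon_ipow_I[OF mon_block_in_I[of \<beta>]]] insert by simp
qed

text \<open>
  For \<open>t = n - 1\<close> the blocks containing \<open>K\<close> form a derived design, which covers the points
  outside \<open>K\<close> evenly; the product of their generators is therefore a power of
  \<open>\<Prod>i\<notin>K. l i\<close>.
\<close>

lemma mon_complement_in_ipow:
  assumes t: "t = n - 1" and K: "K \<subseteq> {1..v}" "card K < n"
  shows "\<exists>D N. 0 < D \<and> D \<le> card B + 1 \<and> D * ((n - card K) * v) \<le> N * ((v - n) * n)
    \<and> mon (\<lambda>i. D * (if i \<in> K then 0 else 1)) \<in> ipow I N"
proof (cases "card K < t")
  case False
  \<comment> \<open>Here the complement of \<open>K\<close> itself gives a generator; D = N = 1, and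
    the required rate is \<open>v_le\<close>.\<close>
  then have "card K = n - 1" using K t by simp
  then show ?thesis
    using mon_ipow_I[OF mon_small_in_I[OF finite_subset[OF K(1)] K(2)]] v_le n_ge
    by (intro exI[of _ 1]) auto
next
  case True
  let ?F = "{\<beta>\<in>B. K \<subseteq> \<beta>}"
  have fin: "finite K" "finite ?F" using K finite_subset finite_B by auto
  obtain x where x: "x \<in> {1..v} - K"
    using K card_mono[OF fin(1), of "{1..v}"] n_less by fastforce
  define N where "N = blocks_over K"
  define \<mu> where "\<mu> = blocks_over (insert x K)"
  have \<mu>: "(v - card K) * \<mu> = N * (n - card K)"
    unfolding \<mu>_def N_def by (rule blocks_over_insert[OF K(1) True x])
  have Npos: "0 < N" unfolding N_def using K True by (intro blocks_over_pos) auto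
  have missed: "card {\<beta>\<in>?F. i \<notin> \<beta>} = N - \<mu>" if "i \<in> {1..v} - K" for i
  proof -
    have "{\<beta>\<in>?F. i \<notin> \<beta>} = ?F - {\<beta>\<in>B. insert i K \<subseteq> \<beta>}" by auto
    then have "card {\<beta>\<in>?F. i \<notin> \<beta>} = N - blocks_over (insert i K)"
      unfolding N_def blocks_over_def using finite_B by (simp add: card_Diff_subset subset_iff)
    also have "blocks_over (insert i K) = \<mu>"
      unfolding \<mu>_def using that x K fin True by (intro blocks_over_eq) auto
    finally show ?thesis .
  qed
  have "mon (\<lambda>i. card {\<beta>\<in>?F. i \<notin> \<beta>}) \<in> ipow I N"
    unfolding N_def blocks_over_def by (rule mon_blocks_in_ipow[OF fin(2)]) auto
  moreover have "card {\<beta>\<in>?F. i \<notin> \<beta>} = (N - \<mu>) * (if i \<in> K then 0 else 1)" if "i \<in> {1..v}" for i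
  proof (cases "i \<in> K")
    case True
    then have "{\<beta>\<in>?F. i \<notin> \<beta>} = {}" by auto
    then show ?thesis using True by (simp only: card.empty) simp
  qed (use missed that in simp)
  ultimately have mem: "mon (\<lambda>i. (N - \<mu>) * (if i \<in> K then 0 else 1)) \<in> ipow I N"
    by (elim mon_ipow_mono) simp
  \<comment> \<open>Both sides count pairs of a block over \<open>K\<close> and a point it
    misses.\<close>
  have D: "(N - \<mu>) * (v - card K) = N * (v - n)"
  proof -
    have "(N - \<mu>) * (v - card K) = N * (v - card K) - N * (n - card K)"
      using \<mu> by (simp add: diff_mult_distrib mult.commute)
    also have "\<dots> = N * (v - n)"
      using K n_less by (simp flip: diff_mult_distrib2)
    finally show ?thesis .
  qed
  have "0 < N - \<mu>" using D Npos n_less by (metis mult_is_0 neq0_conv zero_less_diff)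
  moreover have "N - \<mu> \<le> card B + 1"
    unfolding N_def blocks_over_def using card_mono[OF finite_B, of ?F] by auto
  moreover have "(N - \<mu>) * ((n - card K) * v) \<le> N * ((v - n) * n)"
  proof -
    have "(n - card K) * v \<le> (v - card K) * n"
    proof -
      have "card K * n \<le> card K * v" using n_less by (intro mult_le_mono2) simp
      then show ?thesis by (simp only: diff_mult_distrib mult.commute[of n v] diff_le_mono2)
    qed
    then have "(N - \<mu>) * ((n - card K) * v) \<le> (N - \<mu>) * ((v - card K) * n)" by (rule mult_le_mono2)
    also have "\<dots> = N * ((v - n) * n)" using D by (simp flip: mult.assoc)
    finally show ?thesis .
  qed
  ultimately show ?thesis using mem by blast
qed

text \<open>Bounds \<open>D * ((n - card K) * v)\<close>, the price of a remainder of at most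
  \<open>D\<close>, uniformly in \<open>K\<close> and independently of the exponents
  \<open>m\<close> and \<open>r\<close>.\<close>

definition "loss = (card B + 1) * (n * v)"

text \<open>
  Subtracting the minimum of \<open>b\<close> outside \<open>K\<close>, rounded down to a multiple of \<open>D\<close>, enlarges the
  zero set \<open>K\<close> by a point; each of these steps costs at most \<open>loss\<close> by rounding.
\<close>

lemma mon_star_in_ipow_loss:
  assumes t: "t = n - 1" and "K \<subseteq> {1..v}" "card K \<le> n"
    and "\<And>\<rho>. \<rho> \<subseteq> {1..v} - K \<Longrightarrow> card \<rho> = n - card K \<Longrightarrow> m \<le> (\<Sum>i\<in>\<rho>. b i)"
    and "r * ((v - n) * n) + (n - card K) * loss \<le> m * v"
  shows "mon b \<in> ipow I r"
  using assms(2-5)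
proof (induction "n - card K" arbitrary: K m b r)
  case 0
  \<comment> \<open>The empty set is now an admissible \<rho> and forces \<open>m = 0\<close>; since
    (v - n) n > 0, also \<open>r = 0\<close>.\<close>
  then have "m = 0" using "0.prems"(3)[of "{}"] by simp
  then have "r = 0" using 0 n_ge n_less by simp
  then show ?case using ipow_zero[OF mon_closed] by simp
next
  case (Suc k)
  have finK: "finite K" using Suc.prems(1) finite_subset by blast
  have Kn: "card K < n" using Suc.hyps(2) by simp
  obtain D N where D: "0 < D" "D \<le> card B + 1" "D * ((n - card K) * v) \<le> N * ((v - n) * n)"
    and mon: "mon (\<lambda>i. D * (if i \<in> K then 0 else 1)) \<in> ipow I N"
    using mon_complement_in_ipow[OF t Suc.prems(1) Kn] by blast
  have "\<exists>x. x \<in> {1..v} - K" using Kn card_mono[OF finK, of "{1..v}"] n_less by fastforce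
  then obtain x where x: "x \<in> {1..v} - K" and min: "\<And>y. y \<in> {1..v} - K \<Longrightarrow> b x \<le> b y"
    using ex_has_least_nat[of "\<lambda>x. x \<in> {1..v} - K" _ b] by blast
  define q where "q = b x div D"
  \<comment> \<open>\<open>?a\<close> uses only \<open>q * D\<close>, while \<open>?b'\<close> gives
    up all of \<open>b x\<close>: then \<open>x\<close> has exponent 0 and joins \<open>K\<close>,
    at the price of a remainder of at most \<open>D\<close>.\<close>
  let ?a = "\<lambda>i. q * (D * (if i \<in> K then 0 else 1))" and ?b' = "\<lambda>i. if i \<in> K then b i else b i - b x"
  have a: "mon ?a \<in> ipow I (q * N)" by (rule mon_ipow_power[OF mon])
  have qD: "q * D \<le> b x" "b x \<le> q * D + D"
    using mod_less_divisor[OF D(1), of "b x"] div_mult_mod_eq[of "b x" D] unfolding q_def by linarith+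
  have ab: "?a i + ?b' i \<le> b i" if "i \<in> {1..v}" for i
    using min[of i] that qD by (cases "i \<in> K") auto
  have "mon ?b' \<in> ipow I (r - q * N)"
  proof (cases "r \<le> q * N")
    case True
    then show ?thesis using ipow_zero[OF mon_closed] by simp
  next
    case False
    then have le: "q * N * ((v - n) * n) \<le> r * ((v - n) * n)" by (intro mult_le_mono1) simp
    show ?thesis
    proof (rule Suc.hyps(1))
      show "k = n - card (insert x K)" "card (insert x K) \<le> n" "insert x K \<subseteq> {1..v}"
        using Suc.hyps(2) x finK Suc.prems(1) by auto
      show "m - b x * (n - card K) \<le> (\<Sum>i\<in>\<rho>. ?b' i)"
        if \<rho>: "\<rho> \<subseteq> {1..v} - insert x K" "card \<rho> = n - card (insert x K)" for \<rho>
      proof -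
        have fin: "finite \<rho>" "x \<notin> \<rho>" using \<rho> finite_subset by auto
        have c: "n - card K = Suc (card \<rho>)" using \<rho>(2) x finK Kn by simp
        have "m \<le> (\<Sum>i\<in>insert x \<rho>. b i)"
          using \<rho> x fin c by (intro Suc.prems(3)) auto
        also have "\<dots> = b x + (\<Sum>i\<in>\<rho>. b x + ?b' i)"
        proof -
          have "(\<Sum>i\<in>\<rho>. b i) = (\<Sum>i\<in>\<rho>. b x + ?b' i)"
            using \<rho>(1) min by (intro sum.cong) (auto simp: subset_iff)
          then show ?thesis using fin by simp
        qed
        also have "\<dots> = b x * (n - card K) + (\<Sum>i\<in>\<rho>. ?b' i)"
          unfolding c by (simp add: sum.distrib)
        finally show ?thesis by simp
      qed
      have k: "n - card (insert x K) = k" "n - card K = Suc k" using Suc.hyps(2) x finK by auto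
      \<comment> \<open>The rate in \<open>D(3)\<close> pays for the part \<open>q * D\<close> of
        \<open>b x\<close>; the remainder is charged to \<open>loss\<close>.\<close>
      have "b x * (Suc k * v) \<le> q * (D * (Suc k * v)) + D * (Suc k * v)"
        using mult_le_mono1[OF qD(2), of "Suc k * v"] by (simp add: algebra_simps)
      also have "q * (D * (Suc k * v)) \<le> q * (N * ((v - n) * n))"
        using D(3) unfolding k by (rule mult_le_mono2)
      also have "D * (Suc k * v) \<le> loss"
        unfolding loss_def using D(2) k(2) by (intro mult_le_mono) auto
      finally have "b x * Suc k * v \<le> q * N * ((v - n) * n) + loss" by (simp only: mult.assoc)
      moreover have "(r - q * N) * ((v - n) * n) = r * ((v - n) * n) - q * N * ((v - n) * n)"
        "(m - b x * Suc k) * v = m * v - b x * Suc k * v"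
        by (rule diff_mult_distrib)+
      moreover have "r * ((v - n) * n) + (loss + k * loss) \<le> m * v"
        using Suc.prems(4) unfolding k by simp
      ultimately show "(r - q * N) * ((v - n) * n) + (n - card (insert x K)) * loss
          \<le> (m - b x * (n - card K)) * v"
        unfolding k using le by linarith
    qed
  qed
  from mon_ipow_add[OF a this] have "mon (\<lambda>i. ?a i + ?b' i) \<in> ipow I r"
    by (rule ipow_antimono[rotated]) simp
  then show ?case by (rule mon_ipow_mono) (rule ab)
qed

text \<open>Starting from \<open>K = {}\<close>, the zero set is enlarged \<open>n\<close> times,
  hence the term \<open>n * loss\<close>.\<close>

lemma symb_subset_loss:
  assumes t: "t = n - 1" and m: "r * ((v - n) * n) + n * loss \<le> m * v"
  shows "symb m \<subseteq> ipow I r"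
  unfolding symb_eq
proof (rule gen_subset[OF R.ideal_pow[OF I_ideal]])
  fix b :: "nat \<Rightarrow> nat" assume "\<forall>\<sigma>\<in>C. m \<le> (\<Sum>i\<in>\<sigma>. b i)"
  then obtain p a b' where p: "p \<le> m" "mon a \<in> ipow I p"
    and b: "\<And>i. i \<in> {1..v} \<Longrightarrow> b i = a i + b' i"
    and b': "\<And>\<sigma>. \<sigma> \<in> subsets_of_size n v \<Longrightarrow> m - p \<le> (\<Sum>i\<in>\<sigma>. b' i)"
    using mon_star_reduction by metis
  have "mon b' \<in> ipow I (r - p)"
  proof (cases "r \<le> p")
    case True
    then show ?thesis using ipow_zero[OF mon_closed] by simp
  next
    case False
    have "p * v \<le> p * ((v - n) * n)" using v_le by (rule mult_le_mono2)
    moreover have "p * ((v - n) * n) \<le> r * ((v - n) * n)" using False by (intro mult_le_mono1) simp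
    ultimately have "(r - p) * ((v - n) * n) + n * loss \<le> (m - p) * v"
      using m by (simp only: diff_mult_distrib)
    then show ?thesis
      by (intro mon_star_in_ipow_loss[OF t, of "{}" "m - p"]) (auto intro!: b' simp: subsets_of_size_def)
  qed
  from mon_ipow_add[OF p(2) this] have "mon (\<lambda>i. a i + b' i) \<in> ipow I r"
    by (rule ipow_antimono[rotated]) simp
  then show "mon b \<in> ipow I r" by (rule mon_ipow_mono) (simp add: b)
qed

section \<open>Resurgence\<close>

lemma resurgence_le: "resurgence n l C \<le> ereal ((real v - real n + 1) * real n / real v)"
  unfolding resurgence_def I_def[symmetric]
proof (rule Sup_least)
  fix x assume "x \<in> {ereal (real m / real r) |m r. 0 < m \<and> 0 < r \<and> \<not> symb m \<subseteq> ipow I r}"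
  then obtain m r where x: "x = ereal (real m / real r)" and "0 < r" "\<not> symb m \<subseteq> ipow I r" by blast
  then have "\<not> r * (v - n + 1) * n \<le> m * v" using symb_subset by blast
  then have "real (m * v) \<le> real (r * (v - n + 1) * n)" by (simp only: of_nat_le_iff)
  then have "real m * real v \<le> real r * ((real v - real n + 1) * real n)"
  proof -
    have "real (v - n + 1) = real v - real n + 1" using n_less by (simp add: of_nat_diff)
    then show ?thesis using \<open>real (m * v) \<le> _\<close> by (simp only: of_nat_mult mult.assoc)
  qed
  then show "x \<le> ereal ((real v - real n + 1) * real n / real v)"
    using \<open>0 < r\<close> n_less unfolding x by (simp add: field_simps)
qed

text \<open>A single positive \<open>s\<close> with noncontainment suffices, as (m s) / (r s) = m /
  r.\<close>

lemma asymptotic_resurgence_le_resurgence: "asymptotic_resurgence n l C \<le> resurgence n l C"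
  unfolding resurgence_def asymptotic_resurgence_def I_def[symmetric]
proof (rule Sup_subset_mono, rule subsetI)
  fix x
  assume "x \<in> {ereal (real m / real r) |m r. 0 < m \<and> 0 < r \<and>
      (\<forall>\<^sub>F s in sequentially. \<not> symb (m * s) \<subseteq> ipow I (r * s))}"
  then obtain m r where x: "x = ereal (real m / real r)" and mr: "0 < m" "0 < r"
    and "\<forall>\<^sub>F s in sequentially. \<not> symb (m * s) \<subseteq> ipow I (r * s)" by blast
  then obtain s0 where s0: "\<And>s. s0 \<le> s \<Longrightarrow> \<not> symb (m * s) \<subseteq> ipow I (r * s)"
    by (auto simp: eventually_sequentially)
  have "\<not> symb (m * Suc s0) \<subseteq> ipow I (r * Suc s0)" by (rule s0) simp
  moreover have "real m / real r = real (m * Suc s0) / real (r * Suc s0)"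
    unfolding of_nat_mult by (simp del: of_nat_Suc)
  moreover have "0 < m * Suc s0" "0 < r * Suc s0" using mr by simp_all
  ultimately show "x \<in> {ereal (real m / real r) |m r. 0 < m \<and> 0 < r \<and> \<not> symb m \<subseteq> ipow I r}"
    unfolding x by blast
qed

lemma asymptotic_resurgence_ge:
  "ereal ((real v - real n) * real n / real v) \<le> asymptotic_resurgence n l C"
proof -
  let ?c = "(real v - real n) * real n / real v"
  have c: "0 < ?c" using n_less n_ge by simp
  have mem: "ereal (real m / real r) \<le> asymptotic_resurgence n l C"
    if mr: "0 < m" "0 < r" "real m / real r < ?c" for m r :: nat
    unfolding asymptotic_resurgence_def I_def[symmetric]
  proof (rule Sup_upper, safe)
    have "real m * real v < real r * ((real v - real n) * real n)"
      using mr n_less by (simp add: field_simps)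
    then have "real (m * v) < real (r * (v - n) * n)" using n_less by (simp add: of_nat_diff)
    then have less: "m * v < r * (v - n) * n" by (simp only: of_nat_less_iff)
    \<comment> \<open>Rounding m s / n up costs at most n v after scaling, whereas the strict
      integer inequality \<open>less\<close> gains at least \<open>s\<close>.\<close>
    have "\<not> symb (m * s) \<subseteq> ipow I (r * s)" if s: "n * v < s" for s
    proof (rule symb_not_subset)
      let ?j = "m * s div n + 1"
      have "n * (m * s div n) + m * s mod n = m * s" by (rule mult_div_mod_eq)
      moreover have "m * s mod n < n" using n_ge by simp
      moreover have "n * ?j = n * (m * s div n) + n" by simp
      ultimately have j: "m * s \<le> n * ?j" "n * ?j \<le> m * s + n" by linarith+
      show "m * s \<le> n * ?j" by (rule j)
      have "n * (?j * v) \<le> (m * s + n) * v" using mult_le_mono1[OF j(2), of v] by (simp only: mult.assoc)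
      also have "\<dots> < (m * v + 1) * s" using s by (simp add: algebra_simps)
      also have "\<dots> \<le> (r * (v - n) * n) * s" using less by (intro mult_le_mono1) simp
      finally have "n * (?j * v) < n * (r * s * (v - n))" by (simp add: mult_ac)
      then show "?j * v < r * s * (v - n)" by (metis nat_mult_less_cancel_disj)
    qed
    then have ev: "\<forall>\<^sub>F s in sequentially. \<not> symb (m * s) \<subseteq> ipow I (r * s)"
      by (auto simp: eventually_sequentially intro!: exI[of _ "Suc (n * v)"])
    show "\<exists>m' r'. ereal (real m / real r) = ereal (real m' / real r') \<and> 0 < m' \<and> 0 < r'
        \<and> (\<forall>\<^sub>F s in sequentially. \<not> symb (m' * s) \<subseteq> ipow I (r' * s))"
      using mr ev by blast
  qed
  show ?thesis
  proof (rule ccontr)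
    assume "\<not> ?thesis"
    then have "asymptotic_resurgence n l C < ereal ?c" by simp
    \<comment> \<open>The maximum with 0 makes \<open>q\<close> positive, so that it is a quotient
      of positive naturals.\<close>
    then have "max (asymptotic_resurgence n l C) 0 < ereal ?c" using c by simp
    then obtain y where "max (asymptotic_resurgence n l C) 0 < ereal y" "ereal y < ereal ?c"
      using ereal_dense2 by blast
    then have y: "0 < y" "y < ?c" "asymptotic_resurgence n l C < ereal y" by auto
    obtain q where q: "q \<in> \<rat>" "y < q" "q < ?c" using Rats_dense_in_real y by blast
    then obtain m r where mr: "r \<noteq> 0" "\<bar>q\<bar> = real m / real r" "coprime m r"
      using Rats_abs_nat_div_natE by metis
    then have eq: "q = real m / real r" using q y by simp
    then have "0 < m" using q y by (cases "m = 0") auto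
    then have "ereal q \<le> asymptotic_resurgence n l C" using mem[of m r] mr eq q by simp
    moreover have "asymptotic_resurgence n l C < ereal q"
      using y(3) q(2) by (metis ereal_less_eq(3) less_le_trans less_imp_le)
    ultimately show False by simp
  qed
qed

lemma asymptotic_resurgence_le:
  assumes t: "t = n - 1"
  shows "asymptotic_resurgence n l C \<le> ereal ((real v - real n) * real n / real v)"
  unfolding asymptotic_resurgence_def I_def[symmetric]
proof (rule Sup_least, safe)
  fix m r :: nat
  assume mr: "0 < m" "0 < r" and ev: "\<forall>\<^sub>F s in sequentially. \<not> symb (m * s) \<subseteq> ipow I (r * s)"
  have "m * v \<le> r * ((v - n) * n)"
  proof (rule ccontr)
    assume "\<not> ?thesis"
    then have less: "r * ((v - n) * n) + 1 \<le> m * v" by simp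
    \<comment> \<open>The excess of at least 1 in \<open>less\<close> grows to at least
      \<open>s\<close> and absorbs the constant loss.\<close>
    have "symb (m * s) \<subseteq> ipow I (r * s)" if "n * loss \<le> s" for s
    proof (rule symb_subset_loss[OF t])
      have "(r * ((v - n) * n) + 1) * s \<le> m * v * s" using less by (rule mult_le_mono1)
      then show "r * s * ((v - n) * n) + n * loss \<le> m * s * v"
        using that by (simp add: algebra_simps)
    qed
    then have "\<forall>\<^sub>F s in sequentially. symb (m * s) \<subseteq> ipow I (r * s)"
      by (auto simp: eventually_sequentially)
    with ev have "\<forall>\<^sub>F s in sequentially. False" by eventually_elim simp
    then show False by simp
  qed
  then have "real (m * v) \<le> real (r * ((v - n) * n))" by (simp only: of_nat_le_iff)
  then have "real m * real v \<le> real r * ((real v - real n) * real n)"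
    using n_less by (simp add: of_nat_diff)
  then show "ereal (real m / real r) \<le> ereal ((real v - real n) * real n / real v)"
    using mr n_less by (simp add: field_simps)
qed

end

theorem corollary4p8:
  fixes t n v :: nat and B C :: "nat set set" and l :: "nat \<Rightarrow> 'k::field mpoly"
  assumes "steiner_system t n v B" and "1 \<le> t" and "t < n" and "n < v"
    and "C = subsets_of_size n v - B"
    and "\<And>j. j \<in> {1..v} \<Longrightarrow> linear_form n (l j)"
    and "\<And>\<sigma>. \<sigma> \<in> subsets_of_size (n + 1) v \<Longrightarrow> lin_indep_family l \<sigma>"
  shows "(t = n - 1 \<longrightarrow>
            ereal ((real v - real n) * real n / real v) = asymptotic_resurgence n l C \<and>
            asymptotic_resurgence n l C \<le> resurgence n l C \<and>
            resurgence n l C \<le> ereal ((real v - real n + 1) * real n / real v)) \<and>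
         (t < n - 1 \<longrightarrow>
            ereal ((real v - real n) * real n / real v) \<le> asymptotic_resurgence n l C \<and>
            asymptotic_resurgence n l C \<le> resurgence n l C \<and>
            resurgence n l C \<le> ereal ((real v - real n + 1) * real n / real v))"
proof -
  interpret S: steiner_forms t n v B l
    by unfold_locales (use assms in auto)
  have C: "C = S.C" using assms(5) by (simp add: S.C_def)
  show ?thesis
    unfolding C
    using S.asymptotic_resurgence_ge S.asymptotic_resurgence_le_resurgence S.resurgence_le
      S.asymptotic_resurgence_le by (auto intro: antisym)
qed

end
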